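(* An austere submanifold $M^4\subset\mathbb{R}^{4+r}$ of type B cannot have first normal space of dimension $\delta=5$.
   Context: For an immersed submanifold $M^4\subset\mathbb{R}^{4+r}$ the second fundamental form is $\mathrm{II}(X,Y)=\pi_N\nabla_XY$, and $|\mathrm{II}_p|\subset S^2T_p^*M$ is the space of all quadratic forms $\nu\cdot\mathrm{II}_p$, with $\nu$ normal to $M$ at $p$. $M$ is austere if, for every normal vector $\nu$, the eigenvalues of $\nu\cdot\mathrm{II}$ with respect to the induced metric are symmetrically arranged around zero. The first normal space at $p$ is the image of $\mathrm{II}:S^2T_pM\to N_pM$; its dimension $\delta$ equals $\dim|\mathrm{II}_p|$ and is assumed constant over $M$. $M$ is of type B if for every $p$ the space $|\mathrm{II}_p|$ is $O(4)$-conjugate (in an orthonormal basis of $T_pM$, taken locally to be a smooth frame) to a subspace of the 5-dimensional space $$\mathcal{Q}_B=\left\{\begin{bmatrix}mI&B\\{}^tB&-mI\end{bmatrix}: m\in\mathbb{R},\ B \text{ a real } 2\times2 \text{ matrix}\right\}.$$ *)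

theory Defs
  imports "HOL-Analysis.Analysis"
begin

section \<open>Smooth maps between Euclidean spaces\<close>

primrec C_k_on :: "nat \<Rightarrow> ('a::euclidean_space \<Rightarrow> 'b::real_normed_vector) \<Rightarrow> 'a set \<Rightarrow> bool" where
  "C_k_on 0 f U \<longleftrightarrow> continuous_on U f"
| "C_k_on (Suc k) f U \<longleftrightarrow>
     (\<forall>u\<in>U. f differentiable (at u)) \<and>
     (\<forall>v. C_k_on k (\<lambda>u. frechet_derivative f (at u) v) U)"

definition smooth_map_on :: "'a::euclidean_space set \<Rightarrow> ('a \<Rightarrow> 'b::real_normed_vector) \<Rightarrow> bool" where
  "smooth_map_on U f \<longleftrightarrow> open U \<and> (\<forall>k. C_k_on k f U)"


section \<open>Immersed submanifolds\<close>

text \<open>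
  A smooth atlas consists of local parametrizations \<open>(U, \<phi>)\<close>, where \<open>\<phi>\<close> maps the open
  set \<open>U\<close> of coordinates homeomorphically onto an open subset of the manifold; so \<open>\<phi>\<close> is
  the inverse of a coordinate chart.
\<close>

type_synonym ('m, 'd) atlas = "((real^'d) set \<times> (real^'d \<Rightarrow> 'm)) set"

definition smooth_atlas :: "'m topology \<Rightarrow> ('m, 'd::finite) atlas \<Rightarrow> bool" where
  "smooth_atlas X A \<longleftrightarrow>
     (\<forall>(U, \<phi>)\<in>A. open U \<and> openin X (\<phi> ` U) \<and>
        homeomorphic_map (top_of_set U) (subtopology X (\<phi> ` U)) \<phi>) \<and>
     (\<Union>(U, \<phi>)\<in>A. \<phi> ` U) = topspace X \<and>
     (\<forall>(U, \<phi>)\<in>A. \<forall>(V, \<psi>)\<in>A.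
        smooth_map_on {u \<in> U. \<phi> u \<in> \<psi> ` V} (inv_into V \<psi> \<circ> \<phi>))"

definition smooth_manifold :: "'m topology \<Rightarrow> ('m, 'd::finite) atlas \<Rightarrow> bool" where
  "smooth_manifold X A \<longleftrightarrow> Hausdorff_space X \<and> second_countable X \<and> smooth_atlas X A"

definition immersion_on :: "(real^'d) set \<Rightarrow> (real^'d \<Rightarrow> real^'n) \<Rightarrow> bool" where
  "immersion_on U g \<longleftrightarrow>
     smooth_map_on U g \<and> (\<forall>u\<in>U. inj (frechet_derivative g (at u)))"

definition immersed_submanifold ::
    "'m topology \<Rightarrow> ('m, 'd::finite) atlas \<Rightarrow> ('m \<Rightarrow> real^'n) \<Rightarrow> bool" where
  "immersed_submanifold X A F \<longleftrightarrow>
     smooth_manifold X A \<and> topspace X \<noteq> {} \<and> (\<forall>(U, \<phi>)\<in>A. immersion_on U (F \<circ> \<phi>))"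


section \<open>The second fundamental form in a parametrization\<close>

text \<open>
  Below, \<open>g = F \<circ> \<phi>\<close> is the immersion read in a local parametrization, and the tangent space
  of the manifold at \<open>\<phi> u\<close> is identified with the coordinate space by means of the
  derivative of \<open>\<phi>\<close>. The image of a coordinate vector \<open>x\<close> in the ambient space is \<open>dg\<^sub>u(x)\<close>.
\<close>

definition tangent_space :: "(real^'d \<Rightarrow> real^'n) \<Rightarrow> real^'d \<Rightarrow> (real^'n) set" where
  "tangent_space g u = range (frechet_derivative g (at u))"

definition normal_space :: "(real^'d \<Rightarrow> real^'n) \<Rightarrow> real^'d \<Rightarrow> (real^'n) set" where
  "normal_space g u = orthogonal_comp (tangent_space g u)"

definition induced_metric :: "(real^'d \<Rightarrow> real^'n) \<Rightarrow> real^'d \<Rightarrow> real^'d \<Rightarrow> real^'d \<Rightarrow> real" where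
  "induced_metric g u x y = frechet_derivative g (at u) x \<bullet> frechet_derivative g (at u) y"

definition normal_projection :: "(real^'d \<Rightarrow> real^'n) \<Rightarrow> real^'d \<Rightarrow> real^'n \<Rightarrow> real^'n" where
  "normal_projection g u w = (THE \<nu>. \<nu> \<in> normal_space g u \<and> w - \<nu> \<in> tangent_space g u)"

text \<open>
  The normal component of the flat ambient derivative, in the direction \<open>x\<close>, of the tangent
  vector field with coordinate expression \<open>Y\<close>.
\<close>

definition normal_derivative ::
    "(real^'d \<Rightarrow> real^'n) \<Rightarrow> real^'d \<Rightarrow> real^'d \<Rightarrow> (real^'d \<Rightarrow> real^'d) \<Rightarrow> real^'n" where
  "normal_derivative g u x Y =
     normal_projection g u
       (frechet_derivative (\<lambda>w. frechet_derivative g (at w) (Y w)) (at u) x)"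

text \<open>
  The vector \<open>y\<close> is extended to the field with constant coordinates; by lemma
  \<open>normal_derivative_eq_second_fundamental_form\<close> any other extension gives the same value.
\<close>

definition second_fundamental_form ::
    "(real^'d \<Rightarrow> real^'n) \<Rightarrow> real^'d \<Rightarrow> real^'d \<Rightarrow> real^'d \<Rightarrow> real^'n" where
  "second_fundamental_form g u x y = normal_derivative g u x (\<lambda>_. y)"

lemma normal_projection_eq:
  assumes "subspace (tangent_space g u)" and "n \<in> normal_space g u" and "w - n \<in> tangent_space g u"
  shows "normal_projection g u w = n"
  unfolding normal_projection_def
proof (rule the_equality)
  show "n \<in> normal_space g u \<and> w - n \<in> tangent_space g u" using assms by simp
next
  fix m assume m: "m \<in> normal_space g u \<and> w - m \<in> tangent_space g u"
  have "m - n \<in> normal_space g u"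
    using m assms(2) by (simp add: normal_space_def subspace_diff subspace_orthogonal_comp)
  moreover have "m - n \<in> tangent_space g u"
    using subspace_diff[OF assms(1) assms(3) conjunct2[OF m]] by simp
  ultimately have "orthogonal (m - n) (m - n)"
    by (auto simp: normal_space_def orthogonal_comp_def)
  then show "m = n" by (simp add: orthogonal_self)
qed

lemma normal_projection_add_tangent:
  assumes sub: "subspace (tangent_space g u)" and t: "t \<in> tangent_space g u"
  shows "normal_projection g u (w + t) = normal_projection g u w"
proof -
  have "w \<in> tangent_space g u + normal_space g u"
    unfolding normal_space_def using subspace_sum_orthogonal_comp[OF sub] by simp
  then obtain s n where sn: "s \<in> tangent_space g u" "n \<in> normal_space g u" "w = s + n"
    by (auto simp: set_plus_def)
  have "s + t \<in> tangent_space g u" using sub sn(1) t by (rule subspace_add)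
  then show ?thesis
    using normal_projection_eq[OF sub sn(2), of w] normal_projection_eq[OF sub sn(2), of "w + t"]
      sn by (simp add: algebra_simps)
qed

lemma normal_derivative_eq_second_fundamental_form:
  assumes g: "smooth_map_on U g" and u: "u \<in> U" and Y: "Y differentiable (at u)"
  shows "normal_derivative g u x Y = second_fundamental_form g u x (Y u)"
proof -
  have U: "open U" and C1: "C_k_on 1 g U" and C2: "C_k_on (Suc 1) g U"
    using g by (auto simp: smooth_map_on_def)
  have dg: "linear (frechet_derivative g (at w))" if "w \<in> U" for w
    using C1 that by (simp add: linear_frechet_derivative)
  have d2: "(\<lambda>w. frechet_derivative g (at w) y) differentiable (at u)" for y
    using C2 u by simp
  define D where "D y = frechet_derivative (\<lambda>w. frechet_derivative g (at w) y) (at u)" for y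
  define Y' where "Y' = frechet_derivative Y (at u)"
  have hD: "((\<lambda>w. frechet_derivative g (at w) y) has_derivative D y) (at u)" for y
    unfolding D_def using d2 frechet_derivative_works by blast
  have hY: "(Y has_derivative Y') (at u)"
    unfolding Y'_def using Y frechet_derivative_works by blast
  have expand: "frechet_derivative g (at w) y =
      (\<Sum>i\<in>UNIV. y $ i *\<^sub>R frechet_derivative g (at w) (axis i 1))" if "w \<in> U" for w y
  proof -
    have "y = (\<Sum>i\<in>UNIV. y $ i *\<^sub>R axis i 1)"
      using basis_expansion[of y] by (simp add: scalar_mult_eq_scaleR)
    then have "frechet_derivative g (at w) y =
        frechet_derivative g (at w) (\<Sum>i\<in>UNIV. y $ i *\<^sub>R axis i 1)" by simp
    then show ?thesis by (simp add: linear_sum[OF dg[OF that]] linear_scale[OF dg[OF that]])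
  qed
  have hYi: "((\<lambda>w. Y w $ i) has_derivative (\<lambda>x. Y' x $ i)) (at u)" for i
    by (rule bounded_linear.has_derivative[OF bounded_linear_vec_nth hY])
  have "((\<lambda>w. \<Sum>i\<in>UNIV. Y w $ i *\<^sub>R frechet_derivative g (at w) (axis i 1)) has_derivative
      (\<lambda>x. \<Sum>i\<in>UNIV. Y u $ i *\<^sub>R D (axis i 1) x +
                Y' x $ i *\<^sub>R frechet_derivative g (at u) (axis i 1))) (at u)"
    by (intro has_derivative_sum has_derivative_scaleR hYi hD)
  then have "((\<lambda>w. frechet_derivative g (at w) (Y w)) has_derivative
      (\<lambda>x. \<Sum>i\<in>UNIV. Y u $ i *\<^sub>R D (axis i 1) x +
                Y' x $ i *\<^sub>R frechet_derivative g (at u) (axis i 1))) (at u)"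
    by (rule has_derivative_transform_within_open[OF _ U u]) (rule expand[symmetric])
  note d1 = frechet_derivative_at[OF this, symmetric]
  have 1: "frechet_derivative (\<lambda>w. frechet_derivative g (at w) (Y w)) (at u) x =
      (\<Sum>i\<in>UNIV. Y u $ i *\<^sub>R D (axis i 1) x) + frechet_derivative g (at u) (Y' x)"
    by (simp only: d1 sum.distrib expand[OF u, of "Y' x"])
  have "((\<lambda>w. \<Sum>i\<in>UNIV. Y u $ i *\<^sub>R frechet_derivative g (at w) (axis i 1)) has_derivative
      (\<lambda>x. \<Sum>i\<in>UNIV. Y u $ i *\<^sub>R D (axis i 1) x)) (at u)"
    by (intro has_derivative_sum has_derivative_scaleR_right hD)
  then have "((\<lambda>w. frechet_derivative g (at w) (Y u)) has_derivative
      (\<lambda>x. \<Sum>i\<in>UNIV. Y u $ i *\<^sub>R D (axis i 1) x)) (at u)"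
    by (rule has_derivative_transform_within_open[OF _ U u]) (rule expand[symmetric])
  note d2' = frechet_derivative_at[OF this, symmetric]
  have 2: "frechet_derivative (\<lambda>w. frechet_derivative g (at w) (Y u)) (at u) x =
      (\<Sum>i\<in>UNIV. Y u $ i *\<^sub>R D (axis i 1) x)"
    by (simp only: d2')
  have "subspace (tangent_space g u)"
    unfolding tangent_space_def
    using linear_subspace_image[OF dg[OF u] subspace_UNIV] by simp
  then show ?thesis
    unfolding second_fundamental_form_def normal_derivative_def 1 2
    by (rule normal_projection_add_tangent) (simp add: tangent_space_def)
qed

text \<open>
  The space \<open>|II|\<close>, each quadratic form being represented by its symmetric bilinear form.
\<close>

definition second_fundamental_forms ::
    "(real^'d \<Rightarrow> real^'n) \<Rightarrow> real^'d \<Rightarrow> (real^'d \<Rightarrow> real^'d \<Rightarrow> real) set" where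
  "second_fundamental_forms g u =
     {\<lambda>x y. \<nu> \<bullet> second_fundamental_form g u x y | \<nu>. \<nu> \<in> normal_space g u}"

definition first_normal_space :: "(real^'d \<Rightarrow> real^'n) \<Rightarrow> real^'d \<Rightarrow> (real^'n) set" where
  "first_normal_space g u = span {second_fundamental_form g u x y | x y. True}"

definition first_normal_dimension ::
    "('m, 'd::finite) atlas \<Rightarrow> ('m \<Rightarrow> real^'n) \<Rightarrow> nat \<Rightarrow> bool" where
  "first_normal_dimension A F \<delta> \<longleftrightarrow>
     (\<forall>(U, \<phi>)\<in>A. \<forall>u\<in>U. dim (first_normal_space (F \<circ> \<phi>) u) = \<delta>)"


section \<open>Austere submanifolds\<close>

text \<open>
  The eigenspace, for the eigenvalue \<open>c\<close>, of the bilinear form \<open>\<beta>\<close> with respect to the induced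
  metric. A symmetric form is diagonalizable, so the dimensions of the eigenspaces are the
  multiplicities of the eigenvalues (and are 0 when \<open>c\<close> is not an eigenvalue).
\<close>

definition eigenspace ::
    "(real^'d \<Rightarrow> real^'n) \<Rightarrow> real^'d \<Rightarrow> (real^'d \<Rightarrow> real^'d \<Rightarrow> real) \<Rightarrow> real \<Rightarrow> (real^'d) set" where
  "eigenspace g u \<beta> c = {x. \<forall>y. \<beta> x y = c * induced_metric g u x y}"

definition austere :: "('m, 'd::finite) atlas \<Rightarrow> ('m \<Rightarrow> real^'n) \<Rightarrow> bool" where
  "austere A F \<longleftrightarrow>
     (\<forall>(U, \<phi>)\<in>A. \<forall>u\<in>U. \<forall>\<beta>\<in>second_fundamental_forms (F \<circ> \<phi>) u. \<forall>c.
        dim (eigenspace (F \<circ> \<phi>) u \<beta> c) = dim (eigenspace (F \<circ> \<phi>) u \<beta> (- c)))"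


section \<open>Type B\<close>

definition Q_B :: "(real^4^4) set" where
  "Q_B = {vector [vector [m,       0,       B$1$1, B$1$2],
                  vector [0,       m,       B$2$1, B$2$2],
                  vector [B$1$1,   B$2$1,   - m,   0],
                  vector [B$1$2,   B$2$2,   0,     - m]] | m (B :: real^2^2). True}"

definition form_matrix :: "('i \<Rightarrow> real^'d) \<Rightarrow> (real^'d \<Rightarrow> real^'d \<Rightarrow> real) \<Rightarrow> real^'i^'i" where
  "form_matrix e \<beta> = (\<chi> i j. \<beta> (e i) (e j))"

definition smooth_orthonormal_frame ::
    "(real^'d \<Rightarrow> real^'n) \<Rightarrow> (real^'d) set \<Rightarrow> (real^'d \<Rightarrow> 'd \<Rightarrow> real^'d) \<Rightarrow> bool" where
  "smooth_orthonormal_frame g V e \<longleftrightarrow>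
     (\<forall>i. smooth_map_on V (\<lambda>v. e v i)) \<and>
     (\<forall>v\<in>V. \<forall>i j. induced_metric g v (e v i) (e v j) = (if i = j then 1 else 0))"

text \<open>
  Conjugating the matrices of the forms by an element of \<open>O(4)\<close> amounts to changing the
  orthonormal basis, so \<open>e\<close> is a frame in which these matrices form a subspace of \<open>Q_B\<close>.
\<close>

definition type_B :: "('m, 4) atlas \<Rightarrow> ('m \<Rightarrow> real^'n) \<Rightarrow> bool" where
  "type_B A F \<longleftrightarrow>
     (\<forall>(U, \<phi>)\<in>A. \<forall>u\<in>U. \<exists>V e. open V \<and> u \<in> V \<and> V \<subseteq> U \<and>
        smooth_orthonormal_frame (F \<circ> \<phi>) V e \<and>
        (\<forall>v\<in>V. form_matrix (e v) ` second_fundamental_forms (F \<circ> \<phi>) v \<subseteq> Q_B))"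

end

theory Submission
  imports Defs
begin

text \<open>
  Near a point, \<open>\<delta> = 5\<close> makes \<open>|II|\<close> all of \<open>\<Q>\<^sub>B\<close>, so in the adapted frame the second fundamental
  form is \<open>h\<^sub>1\<^sub>1 = h\<^sub>2\<^sub>2 = - h\<^sub>3\<^sub>3 = - h\<^sub>4\<^sub>4\<close>, \<open>h\<^sub>1\<^sub>2 = h\<^sub>3\<^sub>4 = 0\<close>, with \<open>h\<^sub>1\<^sub>1, h\<^sub>1\<^sub>3, h\<^sub>1\<^sub>4, h\<^sub>2\<^sub>3, h\<^sub>2\<^sub>4\<close> linearly
  independent. The five quadrics annihilating \<open>\<Q>\<^sub>B\<close> generate all cubics, so the Codazzi equations
  determine \<open>\<nabla>h\<close> completely: these five normal fields span a parallel subbundle of the normal bundle,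
  and the normal connection on it is an explicit linear function of the coefficients \<open>\<omega>\<close> of the
  Levi-Civita connection. Inserting this into the Ricci equations, a suitable linear combination
  with Gauss equations cancels every derivative of \<open>\<omega>\<close> and every quadratic term in \<open>\<omega>\<close>, and leaves
  \<open>|h\<^sub>1\<^sub>4|\<^sup>2 + |h\<^sub>2\<^sub>3|\<^sup>2 = 0\<close>, contradicting independence.
\<close>

section \<open>Smooth maps\<close>

text \<open>Openness of \<open>U\<close> makes the derivative at a point of \<open>U\<close> depend
  on values inside \<open>U\<close> alone, so the recursion on \<open>k\<close> carries agreement on
  \<open>U\<close> to the derivatives.\<close>

lemma C_k_on_cong:
  assumes "open U" "\<And>u. u \<in> U \<Longrightarrow> f u = g u" "C_k_on k f U"
  shows "C_k_on k g U"
  using assms(2,3)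
proof (induction k arbitrary: f g)
  case 0
  then show ?case by (auto cong: continuous_on_cong)
next
  case (Suc k)
  have der: "(g has_derivative frechet_derivative f (at u)) (at u)" if "u \<in> U" for u
  proof (rule has_derivative_transform_within_open[OF _ assms(1) that])
    show "(f has_derivative frechet_derivative f (at u)) (at u)"
      using Suc.prems(2) that frechet_derivative_works by auto
  qed (use Suc.prems(1) in auto)
  then have "g differentiable (at u)" if "u \<in> U" for u
    using that differentiable_def by blast
  moreover have "C_k_on k (\<lambda>u. frechet_derivative g (at u) v) U" for v
  proof (rule Suc.IH)
    show "C_k_on k (\<lambda>u. frechet_derivative f (at u) v) U" using Suc.prems(2) by simp
    show "frechet_derivative f (at u) v = frechet_derivative g (at u) v" if "u \<in> U" for u
      using frechet_derivative_at[OF der[OF that]] by simp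
  qed
  ultimately show ?case by simp
qed

lemma C_k_on_Suc_D: "C_k_on (Suc k) f U \<Longrightarrow> C_k_on k f U"
proof (induction k arbitrary: f)
  case 0
  then show ?case
    by (auto intro!: continuous_at_imp_continuous_on differentiable_imp_continuous_within)
next
  case (Suc k)
  then show ?case by auto
qed

lemma C_k_on_const: "C_k_on k (\<lambda>u. c) U"
  by (induction k arbitrary: c) (simp_all add: frechet_derivative_const)

lemma C_k_on_add:
  assumes "open U" "C_k_on k f U" "C_k_on k g U"
  shows "C_k_on k (\<lambda>u. f u + g u) U"
  using assms(2,3)
proof (induction k arbitrary: f g)
  case 0
  then show ?case by (simp add: continuous_on_add)
next
  case (Suc k)
  have der: "((\<lambda>u. f u + g u) has_derivative
      (\<lambda>v. frechet_derivative f (at u) v + frechet_derivative g (at u) v)) (at u)" if "u \<in> U" for u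
    using Suc.prems that by (auto intro!: has_derivative_add simp: frechet_derivative_works[symmetric])
  have "C_k_on k (\<lambda>u. frechet_derivative (\<lambda>u. f u + g u) (at u) v) U" for v
    by (rule C_k_on_cong[OF assms(1) _ Suc.IH[of "\<lambda>u. frechet_derivative f (at u) v" "\<lambda>u. frechet_derivative g (at u) v"]])
      (use Suc.prems in \<open>auto simp: frechet_derivative_at[OF der, symmetric]\<close>)
  then show ?case using Suc.prems by simp
qed

text \<open>The product rule pairs the derivative of one factor with the other factor
  undifferentiated. The induction therefore generalizes over both maps and weakens the
  undifferentiated one from order \<open>Suc k\<close> to \<open>k\<close>.\<close>

lemma C_k_on_bilinear:
  assumes "bounded_bilinear b" "open U" "C_k_on k f U" "C_k_on k g U"
  shows "C_k_on k (\<lambda>u. b (f u) (g u)) U"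
  using assms(3,4)
proof (induction k arbitrary: f g)
  case 0
  then show ?case by (simp add: bounded_bilinear.continuous_on[OF assms(1)])
next
  case (Suc k)
  have der: "((\<lambda>u. b (f u) (g u)) has_derivative
      (\<lambda>v. b (f u) (frechet_derivative g (at u) v) + b (frechet_derivative f (at u) v) (g u))) (at u)"
    if "u \<in> U" for u
    using Suc.prems that
    by (auto intro!: bounded_bilinear.FDERIV[OF assms(1)] simp: frechet_derivative_works[symmetric])
  have "C_k_on k (\<lambda>u. b (f u) (frechet_derivative g (at u) v) + b (frechet_derivative f (at u) v) (g u)) U" for v
    using Suc.prems C_k_on_Suc_D[OF Suc.prems(1)] C_k_on_Suc_D[OF Suc.prems(2)]
    by (intro C_k_on_add[OF assms(2)] Suc.IH) auto
  then have "C_k_on k (\<lambda>u. frechet_derivative (\<lambda>u. b (f u) (g u)) (at u) v) U" for v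
    by (rule C_k_on_cong[OF assms(2), rotated]) (simp add: frechet_derivative_at[OF der, symmetric])
  moreover have "(\<lambda>u. b (f u) (g u)) differentiable (at u)" if "u \<in> U" for u
    using der[OF that] differentiable_def by blast
  ultimately show ?case by simp
qed

lemma smooth_map_onD: "smooth_map_on U f \<Longrightarrow> C_k_on k f U" "smooth_map_on U f \<Longrightarrow> open U"
  by (auto simp: smooth_map_on_def)

lemma smooth_map_on_differentiable: "smooth_map_on U f \<Longrightarrow> u \<in> U \<Longrightarrow> f differentiable (at u)"
  using smooth_map_onD(1)[of U f "Suc 0"] by simp

lemma smooth_map_on_has_derivative:
  "smooth_map_on U f \<Longrightarrow> u \<in> U \<Longrightarrow> (f has_derivative frechet_derivative f (at u)) (at u)"
  using smooth_map_on_differentiable frechet_derivative_works by blast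

lemma smooth_map_on_cong:
  "\<lbrakk>smooth_map_on U f; \<And>u. u \<in> U \<Longrightarrow> f u = g u\<rbrakk> \<Longrightarrow> smooth_map_on U g"
  unfolding smooth_map_on_def using C_k_on_cong by blast

lemma smooth_map_on_subset:
  assumes "smooth_map_on U f" "open V" "V \<subseteq> U"
  shows "smooth_map_on V f"
proof -
  have "C_k_on k f V" if "C_k_on k f U" for k and f :: "'a \<Rightarrow> 'b"
    using that
  proof (induction k arbitrary: f)
    case 0
    then show ?case using assms(3) continuous_on_subset by auto
  next
    case (Suc k)
    then show ?case using assms(3) by auto
  qed
  then show ?thesis using assms by (auto simp: smooth_map_on_def)
qed

lemma smooth_map_on_const: "open U \<Longrightarrow> smooth_map_on U (\<lambda>u. c)"
  by (simp add: smooth_map_on_def C_k_on_const)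

lemma smooth_map_on_add:
  "smooth_map_on U f \<Longrightarrow> smooth_map_on U g \<Longrightarrow> smooth_map_on U (\<lambda>u. f u + g u)"
  by (auto simp: smooth_map_on_def intro: C_k_on_add)

lemma smooth_map_on_bilinear:
  "bounded_bilinear b \<Longrightarrow> smooth_map_on U f \<Longrightarrow> smooth_map_on U g \<Longrightarrow> smooth_map_on U (\<lambda>u. b (f u) (g u))"
  by (auto simp: smooth_map_on_def intro: C_k_on_bilinear)

lemmas smooth_map_on_scaleR = smooth_map_on_bilinear[OF bounded_bilinear_scaleR]
lemmas smooth_map_on_inner = smooth_map_on_bilinear[OF bounded_bilinear_inner]

lemma smooth_map_on_sum:
  assumes "open U" "\<And>i. i \<in> I \<Longrightarrow> smooth_map_on U (f i)"
  shows "smooth_map_on U (\<lambda>u. \<Sum>i\<in>I. f i u)"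
  using assms(2)
  by (induction I rule: infinite_finite_induct)
    (auto intro: smooth_map_on_add smooth_map_on_const assms(1))

lemma smooth_map_on_frechet_derivative_const:
  assumes "smooth_map_on U f"
  shows "smooth_map_on U (\<lambda>u. frechet_derivative f (at u) v)"
  using smooth_map_onD(1)[OF assms, of "Suc _"] smooth_map_onD(2)[OF assms]
  by (auto simp: smooth_map_on_def)

text \<open>Coordinates are written as inner products with \<open>axis i 1\<close>, so that their
  smoothness is an instance of \<open>smooth_map_on_inner\<close>.\<close>

lemma linear_axis_expansion:
  fixes L :: "real^'d \<Rightarrow> 'b::real_vector"
  assumes "linear L"
  shows "L y = (\<Sum>i\<in>UNIV. (y \<bullet> axis i 1) *\<^sub>R L (axis i 1))"
proof -
  have "y = (\<Sum>i\<in>UNIV. (y \<bullet> axis i 1) *\<^sub>R axis i 1)"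
    using basis_expansion[of y] by (simp add: scalar_mult_eq_scaleR cart_eq_inner_axis)
  then show ?thesis
    using linear_sum[OF assms, of "\<lambda>i. (y \<bullet> axis i 1) *\<^sub>R axis i 1" UNIV]
    by (simp add: linear_scale[OF assms])
qed

text \<open>\<open>C_k_on\<close> differentiates in fixed directions only; expanding the varying
  direction \<open>Y u\<close> in the axis vectors leaves a finite sum of products of smooth
  maps.\<close>

lemma smooth_map_on_frechet_derivative:
  fixes f :: "real^'d \<Rightarrow> 'b::real_normed_vector"
  assumes f: "smooth_map_on U f" and Y: "smooth_map_on U Y"
  shows "smooth_map_on U (\<lambda>u. frechet_derivative f (at u) (Y u))"
proof (rule smooth_map_on_cong)
  have "smooth_map_on U (\<lambda>u. Y u \<bullet> axis i 1)" for i
    using smooth_map_on_inner[OF Y smooth_map_on_const[OF smooth_map_onD(2)[OF f]]] .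
  then show "smooth_map_on U (\<lambda>u. \<Sum>i\<in>UNIV. (Y u \<bullet> axis i 1) *\<^sub>R frechet_derivative f (at u) (axis i 1))"
    by (intro smooth_map_on_sum smooth_map_on_scaleR smooth_map_on_frechet_derivative_const f
        smooth_map_onD(2)[OF f])
next
  fix u assume u: "u \<in> U"
  show "(\<Sum>i\<in>UNIV. (Y u \<bullet> axis i 1) *\<^sub>R frechet_derivative f (at u) (axis i 1)) =
      frechet_derivative f (at u) (Y u)"
    using smooth_map_on_differentiable[OF f u]
    by (intro linear_axis_expansion[symmetric] linear_frechet_derivative)
qed

section \<open>Symmetry of second derivatives\<close>

text \<open>The mean value theorem is applied twice: along \<open>x\<close> to the difference of
  \<open>f\<close> on two opposite sides of the parallelogram, then along \<open>y\<close> to the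
  partial derivative in direction \<open>x\<close>. The second difference is symmetric in
  \<open>x\<close> and \<open>y\<close>, which is what makes it useful below.\<close>

lemma mixed_second_difference:
  fixes f :: "'a::euclidean_space \<Rightarrow> real"
  assumes t: "0 < t"
    and U: "\<And>r s. \<lbrakk>0 \<le> r; r \<le> t; 0 \<le> s; s \<le> t\<rbrakk> \<Longrightarrow> u + r *\<^sub>R x + s *\<^sub>R y \<in> U"
    and f: "\<And>w. w \<in> U \<Longrightarrow> (f has_derivative f' w) (at w)"
    and fx: "\<And>w. w \<in> U \<Longrightarrow> ((\<lambda>w. f' w x) has_derivative f'' w) (at w)"
  shows "\<exists>r s. 0 \<le> r \<and> r \<le> t \<and> 0 \<le> s \<and> s \<le> t \<and>
    f (u + t *\<^sub>R x + t *\<^sub>R y) - f (u + t *\<^sub>R x) - f (u + t *\<^sub>R y) + f u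
      = t * t * f'' (u + r *\<^sub>R x + s *\<^sub>R y) y"
proof -
  define \<phi> where "\<phi> r = f (u + r *\<^sub>R x + t *\<^sub>R y) - f (u + r *\<^sub>R x)" for r
  have lin: "linear (f' w)" "linear (f'' w)" if "w \<in> U" for w
    using f[OF that] fx[OF that] has_derivative_linear by auto
  have "(\<phi> has_derivative (\<lambda>h. f' (u + r *\<^sub>R x + t *\<^sub>R y) (h *\<^sub>R x) - f' (u + r *\<^sub>R x) (h *\<^sub>R x)))
      (at r within {0..t})" if "0 \<le> r" "r \<le> t" for r
  proof -
    have 1: "((\<lambda>r. u + r *\<^sub>R x + t *\<^sub>R y) has_derivative (\<lambda>h. h *\<^sub>R x)) (at r within {0..t})"
      "((\<lambda>r. u + r *\<^sub>R x) has_derivative (\<lambda>h. h *\<^sub>R x)) (at r within {0..t})"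
      by (auto intro!: derivative_eq_intros)
    show ?thesis
      unfolding \<phi>_def
      using U[of r t] U[of r 0] that t
      by (intro has_derivative_diff has_derivative_compose[OF 1(1) f] has_derivative_compose[OF 1(2) f]) auto
  qed
  then obtain r where r: "r \<in> {0<..<t}"
      "\<phi> t - \<phi> 0 = f' (u + r *\<^sub>R x + t *\<^sub>R y) ((t - 0) *\<^sub>R x) - f' (u + r *\<^sub>R x) ((t - 0) *\<^sub>R x)"
    using mvt_simple[OF t, of \<phi> "\<lambda>r h. f' (u + r *\<^sub>R x + t *\<^sub>R y) (h *\<^sub>R x) - f' (u + r *\<^sub>R x) (h *\<^sub>R x)"] by auto
  have U': "u + r *\<^sub>R x + s *\<^sub>R y \<in> U" if "0 \<le> s" "s \<le> t" for s using U r(1) that by auto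
  define \<psi> where "\<psi> s = f' (u + r *\<^sub>R x + s *\<^sub>R y) x" for s
  have "(\<psi> has_derivative (\<lambda>h. f'' (u + r *\<^sub>R x + s *\<^sub>R y) (h *\<^sub>R y))) (at s within {0..t})"
    if "0 \<le> s" "s \<le> t" for s
  proof -
    have 1: "((\<lambda>s. u + r *\<^sub>R x + s *\<^sub>R y) has_derivative (\<lambda>h. h *\<^sub>R y)) (at s within {0..t})"
      by (auto intro!: derivative_eq_intros)
    show ?thesis
      unfolding \<psi>_def by (rule has_derivative_compose[OF 1 fx[OF U'[OF that]]])
  qed
  then obtain s where s: "s \<in> {0<..<t}" "\<psi> t - \<psi> 0 = f'' (u + r *\<^sub>R x + s *\<^sub>R y) ((t - 0) *\<^sub>R y)"
    using mvt_simple[OF t, of \<psi> "\<lambda>s h. f'' (u + r *\<^sub>R x + s *\<^sub>R y) (h *\<^sub>R y)"] by auto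
  have "f (u + t *\<^sub>R x + t *\<^sub>R y) - f (u + t *\<^sub>R x) - f (u + t *\<^sub>R y) + f u = \<phi> t - \<phi> 0"
    by (simp add: \<phi>_def)
  also have "\<dots> = t * (\<psi> t - \<psi> 0)"
    using r(2) U'[of t] U'[of 0] t
    by (simp add: linear_scale[OF lin(1)] \<psi>_def right_diff_distrib)
  also have "\<dots> = t * t * f'' (u + r *\<^sub>R x + s *\<^sub>R y) y"
    using s U'[of s] by (simp add: linear_scale[OF lin(2)])
  finally have eq: "f (u + t *\<^sub>R x + t *\<^sub>R y) - f (u + t *\<^sub>R x) - f (u + t *\<^sub>R y) + f u =
      t * t * f'' (u + r *\<^sub>R x + s *\<^sub>R y) y" .
  have "0 \<le> r" "r \<le> t" "0 \<le> s" "s \<le> t" using r(1) s(1) by auto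
  with eq show ?thesis by (intro exI conjI)
qed

text \<open>One and the same second difference is \<open>t * t\<close> times either mixed
  derivative, each taken at some point of the parallelogram; by continuity both are close to their
  values at \<open>u\<close>.\<close>

lemma second_derivative_symmetric_real:
  fixes f :: "'a::euclidean_space \<Rightarrow> real"
  assumes f: "smooth_map_on U f" and u: "u \<in> U"
  shows "frechet_derivative (\<lambda>w. frechet_derivative f (at w) x) (at u) y =
    frechet_derivative (\<lambda>w. frechet_derivative f (at w) y) (at u) x"
proof -
  define D2 where "D2 x y w = frechet_derivative (\<lambda>w. frechet_derivative f (at w) x) (at w) y" for x y w
  have cont: "continuous (at u) (D2 x y)" for x y
    unfolding D2_def
    by (intro differentiable_imp_continuous_within smooth_map_on_differentiable[OF _ u]
        smooth_map_on_frechet_derivative_const f)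
  have "\<bar>D2 x y u - D2 y x u\<bar> \<le> \<epsilon>" if \<epsilon>: "0 < \<epsilon>" for \<epsilon>
  proof -
    have "\<forall>\<^sub>F w in nhds u. w \<in> U"
      using smooth_map_onD(2)[OF f] u by (rule eventually_nhds_in_open)
    moreover have "\<forall>\<^sub>F w in nhds u. dist (D2 x y w) (D2 x y u) < \<epsilon> / 2" for x y
      using cont[of x y] \<epsilon> unfolding continuous_within tendsto_at_iff_tendsto_nhds
      by (intro tendstoD) auto
    ultimately have "\<forall>\<^sub>F w in nhds u. w \<in> U \<and> dist (D2 x y w) (D2 x y u) < \<epsilon> / 2 \<and>
        dist (D2 y x w) (D2 y x u) < \<epsilon> / 2"
      by (intro eventually_conj)
    then obtain d where d: "0 < d" "\<And>w. dist w u < d \<Longrightarrow> w \<in> U \<and>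
        dist (D2 x y w) (D2 x y u) < \<epsilon> / 2 \<and> dist (D2 y x w) (D2 y x u) < \<epsilon> / 2"
      unfolding eventually_nhds_metric by blast
    define K where "K = norm x + norm y + 1"
    have K: "0 < K" unfolding K_def using norm_ge_zero[of x] norm_ge_zero[of y] by linarith
    \<comment> \<open>With this \<open>t\<close> the parallelogram stays within \<open>d / 2\<close>
      of \<open>u\<close>; the summand 1 keeps the denominator positive when \<open>x\<close> and
      \<open>y\<close> vanish.\<close>
    define t where "t = d / (2 * (norm x + norm y + 1))"
    have t: "0 < t" using d(1) K unfolding t_def K_def by simp
    have dU: "w \<in> U" if "dist w u < d" for w using d(2)[OF that] by simp
    have near: "dist (u + r *\<^sub>R x + s *\<^sub>R y) u < d" if "0 \<le> r" "r \<le> t" "0 \<le> s" "s \<le> t" for r s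
    proof -
      have "norm (r *\<^sub>R x + s *\<^sub>R y) \<le> r * norm x + s * norm y"
        using that norm_triangle_ineq[of "r *\<^sub>R x" "s *\<^sub>R y"] by simp
      also have "\<dots> \<le> t * norm x + t * norm y"
        using that by (intro add_mono mult_right_mono) auto
      also have "\<dots> \<le> t * (norm x + norm y + 1)" using t by (simp add: algebra_simps)
      also have "\<dots> = d / 2" using K unfolding t_def K_def[symmetric] by simp
      also have "\<dots> < d" using d(1) by simp
      finally show ?thesis by (simp add: dist_norm add.assoc)
    qed
    have near': "dist (u + r *\<^sub>R y + s *\<^sub>R x) u < d" if "0 \<le> r" "r \<le> t" "0 \<le> s" "s \<le> t" for r s
      using near[OF that(3,4,1,2)] by (simp add: add_ac)
    note hf = smooth_map_on_has_derivative[OF f]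
    note hf2 = smooth_map_on_has_derivative[OF smooth_map_on_frechet_derivative_const[OF f]]
    have "\<exists>r s. 0 \<le> r \<and> r \<le> t \<and> 0 \<le> s \<and> s \<le> t \<and>
        f (u + t *\<^sub>R x + t *\<^sub>R y) - f (u + t *\<^sub>R x) - f (u + t *\<^sub>R y) + f u
          = t * t * D2 x y (u + r *\<^sub>R x + s *\<^sub>R y)"
      unfolding D2_def by (rule mixed_second_difference[OF t dU hf hf2]) (rule near)
    then obtain r s where 1: "0 \<le> r" "r \<le> t" "0 \<le> s" "s \<le> t"
      "f (u + t *\<^sub>R x + t *\<^sub>R y) - f (u + t *\<^sub>R x) - f (u + t *\<^sub>R y) + f u
        = t * t * D2 x y (u + r *\<^sub>R x + s *\<^sub>R y)" by auto
    have "\<exists>r s. 0 \<le> r \<and> r \<le> t \<and> 0 \<le> s \<and> s \<le> t \<and>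
        f (u + t *\<^sub>R y + t *\<^sub>R x) - f (u + t *\<^sub>R y) - f (u + t *\<^sub>R x) + f u
          = t * t * D2 y x (u + r *\<^sub>R y + s *\<^sub>R x)"
      unfolding D2_def by (rule mixed_second_difference[OF t dU hf hf2]) (rule near')
    then obtain r' s' where 2: "0 \<le> r'" "r' \<le> t" "0 \<le> s'" "s' \<le> t"
      "f (u + t *\<^sub>R y + t *\<^sub>R x) - f (u + t *\<^sub>R y) - f (u + t *\<^sub>R x) + f u
        = t * t * D2 y x (u + r' *\<^sub>R y + s' *\<^sub>R x)" by auto
    have "f (u + t *\<^sub>R y + t *\<^sub>R x) = f (u + t *\<^sub>R x + t *\<^sub>R y)" by (simp add: add_ac)
    then have "t * t * D2 x y (u + r *\<^sub>R x + s *\<^sub>R y) = t * t * D2 y x (u + r' *\<^sub>R y + s' *\<^sub>R x)"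
      using 1(5) 2(5) by linarith
    then have "D2 x y (u + r *\<^sub>R x + s *\<^sub>R y) = D2 y x (u + r' *\<^sub>R y + s' *\<^sub>R x)" using t by simp
    moreover have "dist (D2 x y (u + r *\<^sub>R x + s *\<^sub>R y)) (D2 x y u) < \<epsilon> / 2"
      using d(2) near[OF 1(1-4)] by blast
    moreover have "dist (D2 y x (u + r' *\<^sub>R y + s' *\<^sub>R x)) (D2 y x u) < \<epsilon> / 2"
      using d(2) near'[OF 2(1-4)] by blast
    ultimately show ?thesis unfolding dist_real_def by linarith
  qed
  then have "\<bar>D2 x y u - D2 y x u\<bar> \<le> 0" by (rule field_le_epsilon) simp
  then show ?thesis unfolding D2_def by simp
qed

text \<open>The mean value theorem is a statement about real values, so the vector identity is
  tested against every \<open>\<nu>\<close>.\<close>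

lemma second_derivative_symmetric:
  fixes f :: "'a::euclidean_space \<Rightarrow> 'b::real_inner"
  assumes f: "smooth_map_on U f" and u: "u \<in> U"
  shows "frechet_derivative (\<lambda>w. frechet_derivative f (at w) x) (at u) y =
    frechet_derivative (\<lambda>w. frechet_derivative f (at w) y) (at u) x"
proof -
  have D: "frechet_derivative (\<lambda>w. \<nu> \<bullet> h w) (at w) x = \<nu> \<bullet> frechet_derivative h (at w) x"
    if "smooth_map_on U h" "w \<in> U" for h :: "'a \<Rightarrow> 'b" and \<nu> w x
    using frechet_derivative_at[OF has_derivative_inner_right[OF smooth_map_on_has_derivative[OF that], of \<nu>]]
    by metis
  have "\<nu> \<bullet> frechet_derivative (\<lambda>w. frechet_derivative f (at w) x) (at u) y =
      \<nu> \<bullet> frechet_derivative (\<lambda>w. frechet_derivative f (at w) y) (at u) x" for \<nu>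
  proof -
    have s: "smooth_map_on U (\<lambda>w. \<nu> \<bullet> f w)"
      by (intro smooth_map_on_inner smooth_map_on_const smooth_map_onD(2)[OF f] f)
    have *: "frechet_derivative (\<lambda>w. frechet_derivative (\<lambda>w. \<nu> \<bullet> f w) (at w) x) (at u) y =
        \<nu> \<bullet> frechet_derivative (\<lambda>w. frechet_derivative f (at w) x) (at u) y" for x y
    proof -
      have "((\<lambda>w. frechet_derivative (\<lambda>w. \<nu> \<bullet> f w) (at w) x) has_derivative
          (\<lambda>y. \<nu> \<bullet> frechet_derivative (\<lambda>w. frechet_derivative f (at w) x) (at u) y)) (at u)"
        by (rule has_derivative_transform_within_open
              [OF has_derivative_inner_right[OF smooth_map_on_has_derivative
                [OF smooth_map_on_frechet_derivative_const[OF f] u]] smooth_map_onD(2)[OF f] u])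
          (simp add: D[OF f])
      from frechet_derivative_at[OF this] show ?thesis by metis
    qed
    show ?thesis using second_derivative_symmetric_real[OF s u] by (simp add: *)
  qed
  then show ?thesis using vector_eq_ldot by blast
qed

section \<open>The equations of Gauss, Codazzi and Ricci in an orthonormal frame\<close>

locale immersed_frame =
  fixes g :: "real^'d \<Rightarrow> real^'n" and V :: "(real^'d) set" and e :: "real^'d \<Rightarrow> 'd \<Rightarrow> real^'d"
  assumes immersion: "immersion_on V g" and frame: "smooth_orthonormal_frame g V e"
begin

lemma smooth_g: "smooth_map_on V g" and inj_dg: "u \<in> V \<Longrightarrow> inj (frechet_derivative g (at u))"
  using immersion by (auto simp: immersion_on_def)

lemma open_V: "open V"
  using smooth_g by (rule smooth_map_onD(2))

lemma linear_dg: "u \<in> V \<Longrightarrow> linear (frechet_derivative g (at u))"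
  using smooth_map_on_differentiable[OF smooth_g] linear_frechet_derivative by blast

section \<open>Derivatives along the frame\<close>

definition D :: "'d \<Rightarrow> (real^'d \<Rightarrow> 'b::real_normed_vector) \<Rightarrow> real^'d \<Rightarrow> 'b" where
  "D k f u = frechet_derivative f (at u) (e u k)"

definition E :: "'d \<Rightarrow> real^'d \<Rightarrow> real^'n" where
  "E i = D i g"

text \<open>These are the coefficients of the Levi-Civita connection, whose covariant derivative is
  the tangential part of the ambient one. The indices are, in order, direction, differentiated field
  and component.\<close>

definition \<omega> :: "'d \<Rightarrow> 'd \<Rightarrow> 'd \<Rightarrow> real^'d \<Rightarrow> real" where
  "\<omega> k i j u = D k (E i) u \<bullet> E j u"

definition H :: "'d \<Rightarrow> 'd \<Rightarrow> real^'d \<Rightarrow> real^'n" where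
  "H k i u = second_fundamental_form g u (e u k) (e u i)"

lemma smooth_e: "smooth_map_on V (\<lambda>u. e u i)"
  using frame by (simp add: smooth_orthonormal_frame_def)

lemma smooth_D: "smooth_map_on V f \<Longrightarrow> smooth_map_on V (D k f)"
  unfolding D_def[abs_def] by (rule smooth_map_on_frechet_derivative[OF _ smooth_e])

lemma smooth_E: "smooth_map_on V (E i)"
  unfolding E_def using smooth_g by (rule smooth_D)

lemma smooth_\<omega>: "smooth_map_on V (\<omega> k i j)"
  unfolding \<omega>_def[abs_def] by (intro smooth_map_on_inner smooth_D smooth_E)

lemma D_eq: "(f has_derivative f') (at u) \<Longrightarrow> D k f u = f' (e u k)"
  using frechet_derivative_at unfolding D_def by metis

lemma D_cong:
  assumes "\<And>v. v \<in> V \<Longrightarrow> f v = h v" "smooth_map_on V f" "u \<in> V"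
  shows "D k f u = D k h u"
proof -
  have "(h has_derivative frechet_derivative f (at u)) (at u)"
    by (rule has_derivative_transform_within_open[OF smooth_map_on_has_derivative[OF assms(2,3)] open_V assms(3)])
      (rule assms(1))
  from D_eq[OF this] show ?thesis by (simp add: D_def)
qed

lemma D_bilinear:
  assumes "bounded_bilinear b" "smooth_map_on V f" "smooth_map_on V h" "u \<in> V"
  shows "D k (\<lambda>v. b (f v) (h v)) u = b (f u) (D k h u) + b (D k f u) (h u)"
  using D_eq[OF bounded_bilinear.FDERIV[OF assms(1)
        smooth_map_on_has_derivative[OF assms(2,4)] smooth_map_on_has_derivative[OF assms(3,4)]]]
  by (simp add: D_def)

lemmas D_scaleR = D_bilinear[OF bounded_bilinear_scaleR]
lemmas D_inner = D_bilinear[OF bounded_bilinear_inner]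

lemma D_const: "D k (\<lambda>v. c) u = 0"
  by (simp add: D_def frechet_derivative_const)

lemma D_add:
  assumes "smooth_map_on V f" "smooth_map_on V h" "u \<in> V"
  shows "D k (\<lambda>v. f v + h v) u = D k f u + D k h u"
  using D_eq[OF has_derivative_add[OF
        smooth_map_on_has_derivative[OF assms(1,3)] smooth_map_on_has_derivative[OF assms(2,3)]]]
  by (simp add: D_def)

lemma D_diff:
  assumes "smooth_map_on V f" "smooth_map_on V h" "u \<in> V"
  shows "D k (\<lambda>v. f v - h v) u = D k f u - D k h u"
  using D_eq[OF has_derivative_diff[OF
        smooth_map_on_has_derivative[OF assms(1,3)] smooth_map_on_has_derivative[OF assms(2,3)]]]
  by (simp add: D_def)

lemma D_sum:
  assumes "\<And>i. i \<in> I \<Longrightarrow> smooth_map_on V (f i)" "u \<in> V"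
  shows "D k (\<lambda>v. \<Sum>i\<in>I. f i v) u = (\<Sum>i\<in>I. D k (f i) u)"
  using D_eq[OF has_derivative_sum[OF smooth_map_on_has_derivative[OF assms]]]
  by (simp add: D_def)

section \<open>Orthonormal expansion of tangent vectors and the Gauss formula\<close>

lemma E_orthonormal: "u \<in> V \<Longrightarrow> E i u \<bullet> E j u = (if i = j then 1 else 0)"
  using frame by (simp add: smooth_orthonormal_frame_def induced_metric_def E_def D_def)

lemma E_tangent: "E i u \<in> tangent_space g u"
  by (simp add: E_def D_def tangent_space_def)

text \<open>Injectivity of the differential gives the tangent space dimension
  \<open>CARD('d)\<close>, and the \<open>E i u\<close> are that many orthonormal, hence
  independent, vectors in it.\<close>

lemma tangent_expansion:
  assumes u: "u \<in> V" and t: "t \<in> tangent_space g u"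
  shows "(\<Sum>i\<in>UNIV. (t \<bullet> E i u) *\<^sub>R E i u) = t"
proof -
  let ?B = "range (\<lambda>i. E i u)"
  have inj: "inj (\<lambda>i. E i u)"
  proof (rule injI)
    fix i j assume "E i u = E j u"
    then have "E i u \<bullet> E j u = E j u \<bullet> E j u" by simp
    then show "i = j" by (simp add: E_orthonormal[OF u] split: if_splits)
  qed
  have orth: "pairwise orthogonal ?B"
    using E_orthonormal[OF u] by (auto simp: pairwise_def orthogonal_def)
  have "0 \<notin> ?B" 
  proof
    assume "0 \<in> ?B"
    then obtain i where "E i u = 0" by auto
    then show False using E_orthonormal[OF u, of i i] by simp
  qed
  with orth have "independent ?B" by (rule pairwise_orthogonal_independent)
  moreover have "dim (tangent_space g u) = CARD('d)"
    unfolding tangent_space_def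
    using dim_image_eq[OF linear_dg[OF u] , of UNIV] inj_dg[OF u] by (simp add: inj_on_subset)
  ultimately have "tangent_space g u \<subseteq> span ?B"
    using card_image[OF inj] E_tangent by (intro card_ge_dim_independent) auto
  then have "(\<Sum>b\<in>?B. (t \<bullet> b) *\<^sub>R b) = t"
    using t E_orthonormal[OF u] orth
    by (intro orthonormal_basis_expand) (auto simp: norm_eq_1)
  then show ?thesis using sum.reindex[OF inj, of "\<lambda>b. (t \<bullet> b) *\<^sub>R b"] by simp
qed

lemma frame_expansion:
  assumes u: "u \<in> V"
  shows "(\<Sum>i\<in>UNIV. (frechet_derivative g (at u) x \<bullet> E i u) *\<^sub>R e u i) = x"
proof -
  have "frechet_derivative g (at u) (\<Sum>i\<in>UNIV. (frechet_derivative g (at u) x \<bullet> E i u) *\<^sub>R e u i) =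
      frechet_derivative g (at u) x"
    using tangent_expansion[OF u, of "frechet_derivative g (at u) x"]
    by (simp add: linear_sum[OF linear_dg[OF u]] linear_scale[OF linear_dg[OF u]] E_def D_def tangent_space_def)
  then show ?thesis using inj_dg[OF u] by (simp add: inj_eq)
qed

lemma normal_space_iff:
  assumes "u \<in> V"
  shows "\<nu> \<in> normal_space g u \<longleftrightarrow> (\<forall>i. \<nu> \<bullet> E i u = 0)"
proof
  assume "\<nu> \<in> normal_space g u"
  then show "\<forall>i. \<nu> \<bullet> E i u = 0"
    using E_tangent by (auto simp: normal_space_def orthogonal_comp_def orthogonal_def inner_commute)
next
  assume *: "\<forall>i. \<nu> \<bullet> E i u = 0"
  have "t \<bullet> \<nu> = 0" if "t \<in> tangent_space g u" for t
  proof -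
    have "t \<bullet> \<nu> = (\<Sum>i\<in>UNIV. (t \<bullet> E i u) *\<^sub>R E i u) \<bullet> \<nu>"
      by (simp only: tangent_expansion[OF assms that])
    also have "\<dots> = 0" using * by (simp add: inner_sum_left inner_commute[of "E _ u" \<nu>])
    finally show ?thesis .
  qed
  then show "\<nu> \<in> normal_space g u"
    by (auto simp: normal_space_def orthogonal_comp_def orthogonal_def)
qed

lemma normal_projection_expansion:
  assumes u: "u \<in> V"
  shows "normal_projection g u x = x - (\<Sum>i\<in>UNIV. (x \<bullet> E i u) *\<^sub>R E i u)"
proof (rule normal_projection_eq)
  show sub: "subspace (tangent_space g u)"
    unfolding tangent_space_def using linear_subspace_image[OF linear_dg[OF u] subspace_UNIV] by simp
  show "x - (\<Sum>i\<in>UNIV. (x \<bullet> E i u) *\<^sub>R E i u) \<in> normal_space g u"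
    by (simp add: normal_space_iff[OF u] inner_diff_left inner_sum_left E_orthonormal[OF u] if_distrib cong: if_cong)
  show "x - (x - (\<Sum>i\<in>UNIV. (x \<bullet> E i u) *\<^sub>R E i u)) \<in> tangent_space g u"
    by (auto intro!: subspace_sum[OF sub] subspace_scale[OF sub] E_tangent)
qed

text \<open>\<open>second_fundamental_form\<close> extends its second argument with constant
  coordinates, whereas \<open>E i\<close> uses the frame field. Tensoriality, in
  \<open>normal_derivative_eq_second_fundamental_form\<close>, makes the normal parts agree.\<close>

lemma gauss_formula:
  assumes u: "u \<in> V"
  shows "D k (E i) u = (\<Sum>m\<in>UNIV. \<omega> k i m u *\<^sub>R E m u) + H k i u"
proof -
  have "H k i u = normal_derivative g u (e u k) (\<lambda>w. e w i)"
    unfolding H_def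
    using normal_derivative_eq_second_fundamental_form[OF smooth_g u smooth_map_on_differentiable[OF smooth_e u]]
    by simp
  also have "\<dots> = normal_projection g u (D k (E i) u)"
    by (simp add: normal_derivative_def E_def D_def[abs_def])
  finally show ?thesis by (simp add: normal_projection_expansion[OF u] \<omega>_def)
qed

section \<open>Symmetry, bilinearity and smoothness of the second fundamental form\<close>

lemma second_fundamental_form_eq:
  "second_fundamental_form g u x y =
    normal_projection g u (frechet_derivative (\<lambda>w. frechet_derivative g (at w) y) (at u) x)"
  by (simp add: second_fundamental_form_def normal_derivative_def)

lemma second_fundamental_form_commute:
  assumes u: "u \<in> V"
  shows "second_fundamental_form g u x y = second_fundamental_form g u y x"
  using second_derivative_symmetric[OF smooth_g u, of y x] by (simp add: second_fundamental_form_eq)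

lemma linear_second_fundamental_form:
  assumes u: "u \<in> V"
  shows "linear (\<lambda>x. second_fundamental_form g u x y)" "linear (\<lambda>y. second_fundamental_form g u x y)"
proof -
  have "linear (\<lambda>x. frechet_derivative (\<lambda>w. frechet_derivative g (at w) y) (at u) x)" for y
    using smooth_map_on_differentiable[OF smooth_map_on_frechet_derivative_const[OF smooth_g] u]
    by (rule linear_frechet_derivative)
  then show 1: "linear (\<lambda>x. second_fundamental_form g u x y)" for y
    unfolding second_fundamental_form_eq normal_projection_expansion[OF u]
    by (intro linear_compose_sub linear_compose_sum ballI)
      (auto simp: linear_iff inner_add_left scaleR_add_left)
  show "linear (\<lambda>y. second_fundamental_form g u x y)"
    using 1[of x] by (simp add: second_fundamental_form_commute[OF u, of x])
qed

lemma H_commute: "u \<in> V \<Longrightarrow> H k i u = H i k u"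
  unfolding H_def by (rule second_fundamental_form_commute)

lemma second_fundamental_form_expansion:
  assumes u: "u \<in> V"
  shows "second_fundamental_form g u x y = (\<Sum>i\<in>UNIV. \<Sum>j\<in>UNIV.
    ((frechet_derivative g (at u) x \<bullet> E i u) * (frechet_derivative g (at u) y \<bullet> E j u)) *\<^sub>R H i j u)"
proof -
  note lin = linear_second_fundamental_form[OF u]
  have A: "second_fundamental_form g u (\<Sum>i\<in>UNIV. a i *\<^sub>R e u i) z =
      (\<Sum>i\<in>UNIV. a i *\<^sub>R second_fundamental_form g u (e u i) z)" for a z
    by (simp add: linear_sum[OF lin(1)] linear_scale[OF lin(1)])
  have B: "second_fundamental_form g u z (\<Sum>j\<in>UNIV. a j *\<^sub>R e u j) =
      (\<Sum>j\<in>UNIV. a j *\<^sub>R second_fundamental_form g u z (e u j))" for a z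
    by (simp add: linear_sum[OF lin(2)] linear_scale[OF lin(2)])
  have "second_fundamental_form g u x y = second_fundamental_form g u
      (\<Sum>i\<in>UNIV. (frechet_derivative g (at u) x \<bullet> E i u) *\<^sub>R e u i)
      (\<Sum>j\<in>UNIV. (frechet_derivative g (at u) y \<bullet> E j u) *\<^sub>R e u j)"
    by (simp add: frame_expansion[OF u])
  also have "\<dots> = (\<Sum>i\<in>UNIV. (frechet_derivative g (at u) x \<bullet> E i u) *\<^sub>R
      (\<Sum>j\<in>UNIV. (frechet_derivative g (at u) y \<bullet> E j u) *\<^sub>R H i j u))"
    unfolding A unfolding B H_def ..
  finally show ?thesis by (simp add: scaleR_sum_right)
qed

lemma H_normal:
  assumes u: "u \<in> V"
  shows "H k i u \<bullet> E j u = 0"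
proof -
  have "H k i u = D k (E i) u - (\<Sum>m\<in>UNIV. \<omega> k i m u *\<^sub>R E m u)" by (simp add: gauss_formula[OF u])
  then show ?thesis
    by (simp add: inner_diff_left inner_sum_left E_orthonormal[OF u] \<omega>_def if_distrib cong: if_cong)
qed

text \<open>Solving the Gauss formula for \<open>H\<close> exhibits it as a combination of maps
  already known to be smooth.\<close>

lemma smooth_H: "smooth_map_on V (H k i)"
proof (rule smooth_map_on_cong)
  show "smooth_map_on V (\<lambda>u. D k (E i) u + (\<Sum>m\<in>UNIV. (- 1) *\<^sub>R (\<omega> k i m u *\<^sub>R E m u)))"
    by (intro smooth_map_on_add smooth_D smooth_E smooth_map_on_sum smooth_map_on_scaleR smooth_\<omega>
        smooth_map_on_const open_V)
qed (simp add: gauss_formula sum_negf)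

section \<open>Structure equations of the frame, tangential and normal\<close>

lemma \<omega>_skew:
  assumes u: "u \<in> V"
  shows "\<omega> k i j u = - \<omega> k j i u"
proof -
  have "D k (\<lambda>v. E i v \<bullet> E j v) u = 0"
    using D_cong[of "\<lambda>v. E i v \<bullet> E j v" "\<lambda>v. if i = j then 1 else 0" u k] u
    by (simp add: E_orthonormal smooth_map_on_inner smooth_E D_const)
  then show ?thesis by (simp add: D_inner smooth_E u \<omega>_def inner_commute)
qed

text \<open>Derivatives along frame fields commute up to the Lie bracket of the fields. The bracket
  is computed by applying the same identity to the immersion itself; its coefficients express that
  the connection is torsion-free.\<close>

lemma D_commutator:
  fixes f :: "real^'d \<Rightarrow> 'b::real_inner"
  assumes f: "smooth_map_on V f" and u: "u \<in> V"
  shows "D k (D l f) u - D l (D k f) u = (\<Sum>m\<in>UNIV. (\<omega> k l m u - \<omega> l k m u) *\<^sub>R D m f u)"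
proof -
  \<comment> \<open>\<open>b\<close> is the bracket of the frame fields \<open>k\<close> and
    \<open>l\<close> in coordinates.\<close>
  define b where "b = D k (\<lambda>v. e v l) u - D l (\<lambda>v. e v k) u"
  have *: "D k (D l h) u - D l (D k h) u = frechet_derivative h (at u) b"
    if h: "smooth_map_on V h" for h :: "real^'d \<Rightarrow> 'c::real_inner"
  proof -
    have exp: "frechet_derivative h (at v) y = (\<Sum>i\<in>UNIV. (y \<bullet> axis i 1) *\<^sub>R frechet_derivative h (at v) (axis i 1))"
      if "v \<in> V" for v y
      using smooth_map_on_differentiable[OF h that] by (intro linear_axis_expansion linear_frechet_derivative)
    have sm: "smooth_map_on V (\<lambda>v. e v l \<bullet> axis i 1)" for l i
      by (intro smooth_map_on_inner smooth_e smooth_map_on_const open_V)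
    note smh = smooth_map_on_frechet_derivative_const[OF h]
    \<comment> \<open>This splits off the Hessian of \<open>h\<close>, which is symmetric and
      cancels in the commutator; only the derivatives of the frame vectors survive.\<close>
    have expD: "D k (D l h) u = frechet_derivative (\<lambda>v. frechet_derivative h (at v) (e u l)) (at u) (e u k)
        + frechet_derivative h (at u) (D k (\<lambda>v. e v l) u)" for k l
    proof -
      have "D k (D l h) u = D k (\<lambda>v. \<Sum>i\<in>UNIV. (e v l \<bullet> axis i 1) *\<^sub>R frechet_derivative h (at v) (axis i 1)) u"
        by (rule D_cong[OF _ smooth_D[OF h] u]) (simp only: D_def, rule exp)
      also have "\<dots> = (\<Sum>i\<in>UNIV. (e u l \<bullet> axis i 1) *\<^sub>R D k (\<lambda>v. frechet_derivative h (at v) (axis i 1)) u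
          + (D k (\<lambda>v. e v l) u \<bullet> axis i 1) *\<^sub>R frechet_derivative h (at u) (axis i 1))"
        by (simp add: D_sum D_scaleR D_inner D_const smooth_map_on_scaleR sm smh u smooth_e
            smooth_map_on_const open_V)
      also have "\<dots> = (\<Sum>i\<in>UNIV. (e u l \<bullet> axis i 1) *\<^sub>R D k (\<lambda>v. frechet_derivative h (at v) (axis i 1)) u)
          + (\<Sum>i\<in>UNIV. (D k (\<lambda>v. e v l) u \<bullet> axis i 1) *\<^sub>R frechet_derivative h (at u) (axis i 1))"
        by (rule sum.distrib)
      also have "(\<Sum>i\<in>UNIV. (D k (\<lambda>v. e v l) u \<bullet> axis i 1) *\<^sub>R frechet_derivative h (at u) (axis i 1)) =
          frechet_derivative h (at u) (D k (\<lambda>v. e v l) u)"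
        by (rule exp[OF u, symmetric])
      also have "(\<Sum>i\<in>UNIV. (e u l \<bullet> axis i 1) *\<^sub>R D k (\<lambda>v. frechet_derivative h (at v) (axis i 1)) u) =
          D k (\<lambda>v. frechet_derivative h (at v) (e u l)) u"
      proof -
        have "D k (\<lambda>v. frechet_derivative h (at v) (e u l)) u =
            D k (\<lambda>v. \<Sum>i\<in>UNIV. (e u l \<bullet> axis i 1) *\<^sub>R frechet_derivative h (at v) (axis i 1)) u"
          by (rule D_cong[OF exp smh u])
        then show ?thesis
          by (simp add: D_sum D_scaleR D_const smooth_map_on_scaleR smh u smooth_map_on_const open_V)
      qed
      finally show ?thesis by (simp only: D_def[of k "\<lambda>v. frechet_derivative h (at v) (e u l)" u])
    qed
    have lin: "linear (frechet_derivative h (at u))"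
      using smooth_map_on_differentiable[OF h u] by (rule linear_frechet_derivative)
    show ?thesis
      using second_derivative_symmetric[OF h u, of "e u l" "e u k"]
      by (simp add: expD b_def linear_diff[OF lin])
  qed
  \<comment> \<open>As \<open>E\<close> consists of frame derivatives of \<open>g\<close>, taking
    \<open>h = g\<close> gives the ambient image of the bracket.\<close>
  have "frechet_derivative g (at u) b = D k (E l) u - D l (E k) u"
    using *[OF smooth_g] by (simp add: E_def)
  then have "frechet_derivative g (at u) b \<bullet> E m u = \<omega> k l m u - \<omega> l k m u" for m
    by (simp add: inner_diff_left \<omega>_def)
  then have "b = (\<Sum>m\<in>UNIV. (\<omega> k l m u - \<omega> l k m u) *\<^sub>R e u m)"
    using frame_expansion[OF u, of b] by simp
  moreover have lin: "linear (frechet_derivative f (at u))"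
    using smooth_map_on_differentiable[OF f u] by (rule linear_frechet_derivative)
  ultimately show ?thesis
    using *[OF f] by (simp add: linear_sum[OF lin] linear_scale[OF lin] D_def)
qed

text \<open>When the Gauss formula is differentiated, derivatives of \<open>\<omega>\<close>
  multiply tangent vectors and vanish against \<open>\<nu>\<close>, while each derivative of
  \<open>E m\<close> contributes \<open>H k m\<close>.\<close>

lemma normal_D_D_E:
  assumes u: "u \<in> V" and \<nu>: "\<And>m. \<nu> \<bullet> E m u = 0"
  shows "\<nu> \<bullet> D k (D l (E i)) u = (\<Sum>m\<in>UNIV. \<omega> l i m u * (\<nu> \<bullet> H k m u)) + \<nu> \<bullet> D k (H l i) u"
proof -
  have "D k (D l (E i)) u = D k (\<lambda>v. (\<Sum>m\<in>UNIV. \<omega> l i m v *\<^sub>R E m v) + H l i v) u"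
    by (rule D_cong) (simp_all add: u gauss_formula smooth_D smooth_E)
  also have "\<dots> = (\<Sum>m\<in>UNIV. \<omega> l i m u *\<^sub>R D k (E m) u + D k (\<omega> l i m) u *\<^sub>R E m u) + D k (H l i) u"
    by (simp add: D_add D_sum D_scaleR smooth_map_on_sum smooth_map_on_scaleR smooth_\<omega> smooth_E smooth_H u open_V)
  finally show ?thesis
    by (simp add: inner_add_right inner_sum_right \<nu> gauss_formula[OF u])
qed

text \<open>The normal part of the commutator of \<open>D k\<close> and \<open>D l\<close> on
  \<open>E i\<close>. Each side is a covariant derivative of the second fundamental form, paired
  with \<open>\<nu>\<close>.\<close>

lemma codazzi:
  assumes u: "u \<in> V" and \<nu>: "\<And>m. \<nu> \<bullet> E m u = 0"
  shows "\<nu> \<bullet> D k (H l i) u - (\<Sum>m\<in>UNIV. \<omega> k l m u * (\<nu> \<bullet> H m i u) + \<omega> k i m u * (\<nu> \<bullet> H l m u)) =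
    \<nu> \<bullet> D l (H k i) u - (\<Sum>m\<in>UNIV. \<omega> l k m u * (\<nu> \<bullet> H m i u) + \<omega> l i m u * (\<nu> \<bullet> H k m u))"
proof -
  have "\<nu> \<bullet> (D k (D l (E i)) u - D l (D k (E i)) u) =
      (\<Sum>m\<in>UNIV. (\<omega> k l m u - \<omega> l k m u) * (\<nu> \<bullet> H m i u))"
    by (simp add: D_commutator[OF smooth_E u] inner_sum_right gauss_formula[OF u] inner_add_right \<nu>)
  then show ?thesis
    by (simp add: inner_diff_right normal_D_D_E[OF u \<nu>] sum.distrib left_diff_distrib sum_subtractf)
qed

text \<open>The tangential part of the same commutator. Derivatives of \<open>\<omega>\<close> are
  isolated on the left, ready for the final elimination.\<close>

lemma gauss_equation:
  assumes u: "u \<in> V"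
  shows "D k (\<omega> l i j) u - D l (\<omega> k i j) u =
    (\<Sum>m\<in>UNIV. \<omega> l i m u * \<omega> k j m u - \<omega> k i m u * \<omega> l j m u + (\<omega> k l m u - \<omega> l k m u) * \<omega> m i j u) +
    H l i u \<bullet> H k j u - H k i u \<bullet> H l j u"
proof -
  have *: "D k (\<omega> l i j) u = D k (D l (E i)) u \<bullet> E j u + (\<Sum>m\<in>UNIV. \<omega> l i m u * \<omega> k j m u) + H l i u \<bullet> H k j u"
    for k l
  proof -
    have "D k (\<omega> l i j) u = D l (E i) u \<bullet> D k (E j) u + D k (D l (E i)) u \<bullet> E j u"
      unfolding \<omega>_def[abs_def] by (simp add: D_inner smooth_D smooth_E u)
    moreover have "D l (E i) u \<bullet> D k (E j) u = (\<Sum>m\<in>UNIV. \<omega> l i m u * \<omega> k j m u) + H l i u \<bullet> H k j u"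
    proof -
      have "E m u \<bullet> H k j u = 0" for m using H_normal[OF u] by (simp add: inner_commute)
      then show ?thesis
        by (simp add: gauss_formula[OF u] inner_add_left inner_add_right inner_sum_left inner_sum_right
            E_orthonormal[OF u] H_normal[OF u] if_distrib cong: if_cong) (simp add: mult.commute)
    qed
    ultimately show ?thesis by simp
  qed
  have "(D k (D l (E i)) u - D l (D k (E i)) u) \<bullet> E j u = (\<Sum>m\<in>UNIV. (\<omega> k l m u - \<omega> l k m u) * \<omega> m i j u)"
    by (simp add: D_commutator[OF smooth_E u] inner_sum_left \<omega>_def)
  then show ?thesis by (simp add: * inner_diff_left sum.distrib sum_subtractf)
qed

text \<open>Differentiating the orthogonality of \<open>N a\<close> and \<open>E m\<close> gives the
  tangential part. For the normal part, \<open>con\<close> is tested against the error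
  \<open>x\<close>, which is itself normal, so that \<open>x \<bullet> x = 0\<close>; linear
  independence of the \<open>N b\<close> does not enter.\<close>

lemma weingarten:
  fixes N :: "'i::finite \<Rightarrow> real^'d \<Rightarrow> real^'n"
  assumes u: "u \<in> V" and smooth_N: "\<And>a. smooth_map_on V (N a)"
    and normal: "\<And>a v m. v \<in> V \<Longrightarrow> N a v \<bullet> E m v = 0"
    and con: "\<And>\<nu>. (\<And>m. \<nu> \<bullet> E m u = 0) \<Longrightarrow> \<nu> \<bullet> D k (N a) u = (\<Sum>b\<in>UNIV. c b * (\<nu> \<bullet> N b u))"
  shows "D k (N a) u = (\<Sum>b\<in>UNIV. c b *\<^sub>R N b u) - (\<Sum>m\<in>UNIV. (N a u \<bullet> H k m u) *\<^sub>R E m u)"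
proof -
  have "D k (\<lambda>v. N a v \<bullet> E m v) u = 0" for m
    using D_cong[of "\<lambda>v. N a v \<bullet> E m v" "\<lambda>v. 0" u k] u
    by (simp add: normal smooth_map_on_inner smooth_E smooth_N D_const)
  then have DE: "D k (N a) u \<bullet> E m u = - (N a u \<bullet> H k m u)" for m
    by (simp add: D_inner smooth_E smooth_N u gauss_formula inner_add_right inner_sum_right normal add_eq_0_iff)
  define x where "x = D k (N a) u - ((\<Sum>b\<in>UNIV. c b *\<^sub>R N b u) - (\<Sum>m\<in>UNIV. (N a u \<bullet> H k m u) *\<^sub>R E m u))"
  have xE: "x \<bullet> E m u = 0" for m
    by (simp add: x_def inner_diff_left inner_sum_left DE normal[OF u] E_orthonormal[OF u] if_distrib cong: if_cong)
  have "x \<bullet> x = x \<bullet> D k (N a) u - (\<Sum>b\<in>UNIV. c b * (x \<bullet> N b u))"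
    by (subst (2) x_def) (simp add: inner_diff_right inner_sum_right xE)
  also have "\<dots> = 0" using con[OF xE] by simp
  finally show ?thesis by (simp add: x_def)
qed

text \<open>The normal part of the commutator on \<open>N a\<close>. On the left is the curvature of
  the connection with coefficients \<open>c\<close>, on the right an entry of the commutator of the
  shape operators of \<open>\<nu>\<close> and \<open>N a\<close>.\<close>

lemma ricci_equation:
  fixes N :: "'i::finite \<Rightarrow> real^'d \<Rightarrow> real^'n"
  assumes u: "u \<in> V" and \<nu>: "\<And>m. \<nu> \<bullet> E m u = 0"
    and smooth_N: "\<And>a. smooth_map_on V (N a)"
    and smooth_c: "\<And>k a b. smooth_map_on V (c k a b)"
    and DN: "\<And>k a v. v \<in> V \<Longrightarrow> D k (N a) v =
      (\<Sum>b\<in>UNIV. c k a b v *\<^sub>R N b v) - (\<Sum>m\<in>UNIV. (N a v \<bullet> H k m v) *\<^sub>R E m v)"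
  shows "(\<Sum>b\<in>UNIV. (D k (c l a b) u - D l (c k a b) u
        + (\<Sum>s\<in>UNIV. c l a s u * c k s b u - c k a s u * c l s b u)
        - (\<Sum>m\<in>UNIV. (\<omega> k l m u - \<omega> l k m u) * c m a b u)) * (\<nu> \<bullet> N b u)) =
    (\<Sum>m\<in>UNIV. (N a u \<bullet> H l m u) * (\<nu> \<bullet> H k m u) - (N a u \<bullet> H k m u) * (\<nu> \<bullet> H l m u))"
proof -
  have \<nu>DN: "\<nu> \<bullet> D k (N a) u = (\<Sum>b\<in>UNIV. c k a b u * (\<nu> \<bullet> N b u))" for k a
    by (simp add: DN[OF u] inner_diff_right inner_sum_right \<nu>)
  have DD: "\<nu> \<bullet> D k (D l (N a)) u = (\<Sum>b\<in>UNIV. (D k (c l a b) u + (\<Sum>s\<in>UNIV. c l a s u * c k s b u)) * (\<nu> \<bullet> N b u))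
      - (\<Sum>m\<in>UNIV. (N a u \<bullet> H l m u) * (\<nu> \<bullet> H k m u))" for k l
  proof -
    have "D k (D l (N a)) u = D k (\<lambda>v. (\<Sum>b\<in>UNIV. c l a b v *\<^sub>R N b v) - (\<Sum>m\<in>UNIV. (N a v \<bullet> H l m v) *\<^sub>R E m v)) u"
      by (rule D_cong) (use u DN smooth_D[OF smooth_N] in auto)
    also have "\<dots> = (\<Sum>b\<in>UNIV. c l a b u *\<^sub>R D k (N b) u + D k (c l a b) u *\<^sub>R N b u)
        - (\<Sum>m\<in>UNIV. (N a u \<bullet> H l m u) *\<^sub>R D k (E m) u + D k (\<lambda>v. N a v \<bullet> H l m v) u *\<^sub>R E m u)"
      by (simp add: D_diff D_sum D_scaleR smooth_map_on_sum smooth_map_on_scaleR smooth_map_on_inner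
          smooth_c smooth_N smooth_E smooth_H u open_V)
    finally have "\<nu> \<bullet> D k (D l (N a)) u =
        (\<Sum>s\<in>UNIV. c l a s u * (\<Sum>b\<in>UNIV. c k s b u * (\<nu> \<bullet> N b u)) + D k (c l a s) u * (\<nu> \<bullet> N s u))
        - (\<Sum>m\<in>UNIV. (N a u \<bullet> H l m u) * (\<nu> \<bullet> H k m u))"
      by (simp add: inner_diff_right inner_sum_right inner_add_right \<nu> \<nu>DN gauss_formula[OF u])
    moreover have "(\<Sum>s\<in>UNIV. c l a s u * (\<Sum>b\<in>UNIV. c k s b u * (\<nu> \<bullet> N b u))) =
        (\<Sum>b\<in>UNIV. (\<Sum>s\<in>UNIV. c l a s u * c k s b u) * (\<nu> \<bullet> N b u))"
      by (simp only: sum_distrib_left sum_distrib_right mult.assoc) (rule sum.swap)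
    ultimately show ?thesis by (simp add: sum.distrib distrib_right)
  qed
  have "\<nu> \<bullet> (D k (D l (N a)) u - D l (D k (N a)) u) =
      (\<Sum>m\<in>UNIV. (\<omega> k l m u - \<omega> l k m u) * (\<Sum>b\<in>UNIV. c m a b u * (\<nu> \<bullet> N b u)))"
    by (simp add: D_commutator[OF smooth_N u] inner_sum_right \<nu>DN)
  also have "\<dots> = (\<Sum>b\<in>UNIV. (\<Sum>m\<in>UNIV. (\<omega> k l m u - \<omega> l k m u) * c m a b u) * (\<nu> \<bullet> N b u))"
    by (simp only: sum_distrib_left sum_distrib_right mult.assoc) (rule sum.swap)
  finally show ?thesis
    by (simp add: inner_diff_right DD sum_subtractf left_diff_distrib distrib_right sum.distrib)
qed

end

section \<open>Frames of type B\<close>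

lemma vector_4 [simp]:
  "(vector [x, y, z, t] :: ('a::zero)^4) $ 1 = x"
  "(vector [x, y, z, t] :: ('a::zero)^4) $ 2 = y"
  "(vector [x, y, z, t] :: ('a::zero)^4) $ 3 = z"
  "(vector [x, y, z, t] :: ('a::zero)^4) $ 4 = t"
  unfolding vector_def by simp_all

text \<open>Labels for the five coordinates of \<open>Q_B\<close>: \<open>N0\<close> is the diagonal
  parameter \<open>m\<close>, the others are the positions of the entries of \<open>B\<close> in the
  upper right block.\<close>

datatype normal_index = N0 | N13 | N14 | N23 | N24

lemma UNIV_normal_index: "UNIV = {N0, N13, N14, N23, N24}"
  using normal_index.exhaust by blast

instance normal_index :: finite
  by standard (simp add: UNIV_normal_index)

lemma sum_normal_index: "sum f (UNIV :: normal_index set) = f N0 + f N13 + f N14 + f N23 + f N24"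
  unfolding UNIV_normal_index by (simp add: ac_simps)

text \<open>
  The solution of the Codazzi equations: component \<open>k\<close> of \<open>conn \<omega> a b\<close> is the coefficient of the
  normal field \<open>b\<close> in the normal part of the derivative of the normal field \<open>a\<close> along the \<open>k\<close>-th
  frame vector.
\<close>

fun conn :: "(4 \<Rightarrow> 4 \<Rightarrow> 4 \<Rightarrow> real) \<Rightarrow> normal_index \<Rightarrow> normal_index \<Rightarrow> real^4" where
  "conn w N0 N0 = vector [0, 0, 0, 0]"
| "conn w N0 N13 = vector [- w 2 2 3, - w 1 2 3 + 2 * w 2 1 3, - w 4 1 4, - w 3 1 4 + 2 * w 4 1 3]"
| "conn w N0 N14 = vector [- w 2 2 4, - w 1 2 4 + 2 * w 2 1 4, - w 4 1 3 + 2 * w 3 1 4, - w 3 1 3]"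
| "conn w N0 N23 = vector [2 * w 1 2 3 - w 2 1 3, - w 1 1 3, - w 4 2 4, 2 * w 4 2 3 - w 3 2 4]"
| "conn w N0 N24 = vector [2 * w 1 2 4 - w 2 1 4, - w 1 1 4, 2 * w 3 2 4 - w 4 2 3, - w 3 2 3]"
| "conn w N13 N0 = vector [- 2 * w 1 1 3, - 2 * w 2 1 3, - 2 * w 3 1 3, - 2 * w 4 1 3]"
| "conn w N13 N13 = vector [- 2 * w 3 1 3 - w 4 1 4, - w 3 2 3, 2 * w 1 1 3 + w 2 2 3, w 1 1 4]"
| "conn w N13 N14 = vector [- w 4 1 3 + w 1 3 4, - w 3 2 4 + w 2 3 4, w 2 2 4 + w 3 3 4, w 1 1 3 + w 4 3 4]"
| "conn w N13 N23 = vector [- w 4 2 4 + w 1 1 2, - w 3 1 3 + w 2 1 2, w 2 1 3 + w 3 1 2, w 1 2 4 + w 4 1 2]"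
| "conn w N13 N24 = vector [2 * w 3 2 4 - w 4 2 3, - w 3 1 4, - 2 * w 1 2 4 + w 2 1 4, w 1 2 3]"
| "conn w N14 N0 = vector [- 2 * w 1 1 4, - 2 * w 2 1 4, - 2 * w 3 1 4, - 2 * w 4 1 4]"
| "conn w N14 N13 = vector [- w 3 1 4 - w 1 3 4, - w 4 2 3 - w 2 3 4, w 1 1 4 - w 3 3 4, w 2 2 3 - w 4 3 4]"
| "conn w N14 N14 = vector [- 2 * w 4 1 4 - w 3 1 3, - w 4 2 4, w 1 1 3, w 2 2 4 + 2 * w 1 1 4]"
| "conn w N14 N23 = vector [2 * w 4 2 3 - w 3 2 4, - w 4 1 3, w 1 2 4, w 2 1 3 - 2 * w 1 2 3]"
| "conn w N14 N24 = vector [- w 3 2 3 + w 1 1 2, - w 4 1 4 + w 2 1 2, w 1 2 3 + w 3 1 2, w 2 1 4 + w 4 1 2]"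
| "conn w N23 N0 = vector [- 2 * w 1 2 3, - 2 * w 2 2 3, - 2 * w 3 2 3, - 2 * w 4 2 3]"
| "conn w N23 N13 = vector [- w 3 2 3 - w 1 1 2, - w 4 1 4 - w 2 1 2, w 1 2 3 - w 3 1 2, w 2 1 4 - w 4 1 2]"
| "conn w N23 N14 = vector [- w 3 2 4, 2 * w 3 1 4 - w 4 1 3, - 2 * w 2 1 4 + w 1 2 4, w 2 1 3]"
| "conn w N23 N23 = vector [- w 3 1 3, - 2 * w 3 2 3 - w 4 2 4, 2 * w 2 2 3 + w 1 1 3, w 2 2 4]"
| "conn w N23 N24 = vector [- w 3 1 4 + w 1 3 4, - w 4 2 3 + w 2 3 4, w 1 1 4 + w 3 3 4, w 2 2 3 + w 4 3 4]"
| "conn w N24 N0 = vector [- 2 * w 1 2 4, - 2 * w 2 2 4, - 2 * w 3 2 4, - 2 * w 4 2 4]"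
| "conn w N24 N13 = vector [- w 4 2 3, 2 * w 4 1 3 - w 3 1 4, w 2 1 4, w 1 2 3 - 2 * w 2 1 3]"
| "conn w N24 N14 = vector [- w 4 2 4 - w 1 1 2, - w 3 1 3 - w 2 1 2, w 2 1 3 - w 3 1 2, w 1 2 4 - w 4 1 2]"
| "conn w N24 N23 = vector [- w 4 1 3 - w 1 3 4, - w 3 2 4 - w 2 3 4, w 2 2 4 - w 3 3 4, w 1 1 3 - w 4 3 4]"
| "conn w N24 N24 = vector [- w 4 1 4, - 2 * w 4 2 4 - w 3 2 3, w 2 2 3, w 1 1 4 + 2 * w 2 2 4]"

text \<open>The basis of \<open>Q_B\<close> for these coordinates; \<open>shape a\<close> is the
  matrix of the form given by a normal vector dual to the normal field \<open>a\<close>.\<close>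

fun shape :: "normal_index \<Rightarrow> real^4^4" where
  "shape N0 = vector [vector [1, 0, 0, 0], vector [0, 1, 0, 0], vector [0, 0, - 1, 0], vector [0, 0, 0, - 1]]"
| "shape N13 = vector [vector [0, 0, 1, 0], vector [0, 0, 0, 0], vector [1, 0, 0, 0], vector [0, 0, 0, 0]]"
| "shape N14 = vector [vector [0, 0, 0, 1], vector [0, 0, 0, 0], vector [0, 0, 0, 0], vector [1, 0, 0, 0]]"
| "shape N23 = vector [vector [0, 0, 0, 0], vector [0, 0, 1, 0], vector [0, 1, 0, 0], vector [0, 0, 0, 0]]"
| "shape N24 = vector [vector [0, 0, 0, 0], vector [0, 0, 0, 1], vector [0, 0, 0, 0], vector [0, 1, 0, 0]]"

locale type_B_frame = immersed_frame g V e
  for g :: "real^4 \<Rightarrow> real^'n" and V e +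
  assumes Q_B: "v \<in> V \<Longrightarrow> form_matrix (e v) ` second_fundamental_forms g v \<subseteq> Q_B"
begin

section \<open>The relations of \<open>Q_B\<close> as vector identities, and the Codazzi equations
  they simplify\<close>

lemma H_type_B:
  assumes v: "v \<in> V"
  shows "H 1 2 v = 0" "H 2 1 v = 0" "H 3 4 v = 0" "H 4 3 v = 0"
    "H 2 2 v = H 1 1 v" "H 3 3 v = - H 1 1 v" "H 4 4 v = - H 1 1 v"
proof -
  have *: "\<nu> \<bullet> H 1 2 v = 0 \<and> \<nu> \<bullet> H 3 4 v = 0 \<and> \<nu> \<bullet> H 2 2 v = \<nu> \<bullet> H 1 1 v \<and>
      \<nu> \<bullet> H 3 3 v = - (\<nu> \<bullet> H 1 1 v) \<and> \<nu> \<bullet> H 4 4 v = - (\<nu> \<bullet> H 1 1 v)"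
    if "\<nu> \<in> normal_space g v" for \<nu>
  proof -
    let ?\<beta> = "\<lambda>x y. \<nu> \<bullet> second_fundamental_form g v x y"
    have "form_matrix (e v) ?\<beta> \<in> Q_B"
      using Q_B[OF v] that unfolding second_fundamental_forms_def by blast
    moreover have "form_matrix (e v) ?\<beta> $ i $ j = \<nu> \<bullet> H i j v" for i j
      by (simp add: form_matrix_def H_def)
    moreover obtain m :: real and B :: "real^2^2" where "form_matrix (e v) ?\<beta> =
        vector [vector [m, 0, B$1$1, B$1$2], vector [0, m, B$2$1, B$2$2],
          vector [B$1$1, B$2$1, - m, 0], vector [B$1$2, B$2$2, 0, - m]]"
      using \<open>form_matrix (e v) ?\<beta> \<in> Q_B\<close> unfolding Q_B_def by blast
    ultimately have "\<nu> \<bullet> H i j v = (vector [vector [m, 0, B$1$1, B$1$2], vector [0, m, B$2$1, B$2$2],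
          vector [B$1$1, B$2$1, - m, 0], vector [B$1$2, B$2$2, 0, - m]] :: real^4^4) $ i $ j" for i j
      by metis
    then show ?thesis by simp
  qed
  \<comment> \<open>A normal vector orthogonal to the whole normal space vanishes; this turns the
    scalar relations above into relations between vectors.\<close>
  have zero: "x = 0" if "\<And>m. x \<bullet> E m v = 0" "\<And>\<nu>. \<nu> \<in> normal_space g v \<Longrightarrow> \<nu> \<bullet> x = 0" for x
    using that normal_space_iff[OF v] by (metis inner_eq_zero_iff)
  show "H 1 2 v = 0" "H 3 4 v = 0" by (rule zero; simp add: * H_normal[OF v])+
  then show "H 2 1 v = 0" "H 4 3 v = 0" using H_commute[OF v] by metis+
  have "H 2 2 v - H 1 1 v = 0" "H 3 3 v + H 1 1 v = 0" "H 4 4 v + H 1 1 v = 0"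
    by (rule zero; simp add: * H_normal[OF v] inner_diff_left inner_add_left inner_diff_right inner_add_right)+
  then show "H 2 2 v = H 1 1 v" "H 3 3 v = - H 1 1 v" "H 4 4 v = - H 1 1 v"
    by (simp_all add: add_eq_0_iff)
qed

lemma H_transpose:
  assumes v: "v \<in> V"
  shows "H 3 1 v = H 1 3 v" "H 4 1 v = H 1 4 v" "H 3 2 v = H 2 3 v" "H 4 2 v = H 2 4 v"
  by (rule H_commute[OF v])+

primrec N :: "normal_index \<Rightarrow> real^4 \<Rightarrow> real^'n" where
  "N N0 = H 1 1"
| "N N13 = H 1 3"
| "N N14 = H 1 4"
| "N N23 = H 2 3"
| "N N24 = H 2 4"

lemma smooth_N: "smooth_map_on V (N a)"
  by (cases a) (simp_all add: smooth_H)

lemma N_normal: "v \<in> V \<Longrightarrow> N a v \<bullet> E m v = 0"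
  by (cases a) (simp_all add: H_normal)

text \<open>Orienting the last two indices increasingly leaves six coefficients per direction, so
  that linear arithmetic sees equal quantities as the same unknown.\<close>

lemma \<omega>_normalize:
  assumes "v \<in> V"
  shows "\<omega> k i i v = 0" "\<omega> k 2 1 v = - \<omega> k 1 2 v" "\<omega> k 3 1 v = - \<omega> k 1 3 v" "\<omega> k 4 1 v = - \<omega> k 1 4 v"
    "\<omega> k 3 2 v = - \<omega> k 2 3 v" "\<omega> k 4 2 v = - \<omega> k 2 4 v" "\<omega> k 4 3 v = - \<omega> k 3 4 v"
  using \<omega>_skew[OF assms, of k i i] by simp (rule \<omega>_skew[OF assms])+

lemma D_H_type_B:
  assumes v: "v \<in> V"
  shows "D k (H 1 2) v = 0" "D k (H 2 1) v = 0" "D k (H 3 4) v = 0" "D k (H 4 3) v = 0"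
    "D k (H 2 2) v = D k (H 1 1) v" "D k (H 3 3) v = - D k (H 1 1) v" "D k (H 4 4) v = - D k (H 1 1) v"
    "D k (H 3 1) v = D k (H 1 3) v" "D k (H 4 1) v = D k (H 1 4) v"
    "D k (H 3 2) v = D k (H 2 3) v" "D k (H 4 2) v = D k (H 2 4) v"
proof -
  have 0: "D k f v = 0" if "\<And>u. u \<in> V \<Longrightarrow> f u = 0" "smooth_map_on V f" for f :: "real^4 \<Rightarrow> real^'n"
    using D_cong[of f "\<lambda>_. 0" v k] that v by (simp add: D_const)
  show "D k (H 1 2) v = 0" "D k (H 2 1) v = 0" "D k (H 3 4) v = 0" "D k (H 4 3) v = 0"
    by (simp_all add: 0 H_type_B smooth_H)
  have "D k (\<lambda>u. H 3 3 u + H 1 1 u) v = 0" "D k (\<lambda>u. H 4 4 u + H 1 1 u) v = 0"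
    by (simp_all add: 0 H_type_B smooth_map_on_add smooth_H)
  then show "D k (H 3 3) v = - D k (H 1 1) v" "D k (H 4 4) v = - D k (H 1 1) v"
    by (simp_all add: D_add smooth_H v add_eq_0_iff)
  show "D k (H 2 2) v = D k (H 1 1) v" "D k (H 3 1) v = D k (H 1 3) v" "D k (H 4 1) v = D k (H 1 4) v"
    "D k (H 3 2) v = D k (H 2 3) v" "D k (H 4 2) v = D k (H 2 4) v"
    by (rule D_cong; simp add: H_type_B H_transpose smooth_H v)+
qed

text \<open>
  Each derivative below is found by swapping its direction with a frame index of the differentiated
  \<open>H\<close>, chosen so that the swapped \<open>H\<close> vanishes or is \<open>\<plusminus>H 1 1\<close>.
\<close>

lemma normal_connection:
  assumes u: "u \<in> V" and \<nu>: "\<And>m. \<nu> \<bullet> E m u = 0"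
  shows "\<nu> \<bullet> D k (N a) u = (\<Sum>b\<in>UNIV. conn (\<lambda>p i j. \<omega> p i j u) a b $ k * (\<nu> \<bullet> N b u))"
proof -
  let ?P = "\<lambda>k a. \<nu> \<bullet> D k (N a) u = (\<Sum>b\<in>UNIV. conn (\<lambda>p i j. \<omega> p i j u) a b $ k * (\<nu> \<bullet> N b u))"
  note cod = codazzi[OF u \<nu>]
  note norm = sum_4 sum_normal_index N.simps conn.simps vector_4 H_type_B[OF u] H_transpose[OF u]
    D_H_type_B[OF u] \<omega>_normalize[OF u] inner_zero_right inner_minus_right mult_minus_left mult_minus_right
    mult_zero_left mult_zero_right minus_minus algebra_simps
  have "?P 1 N0"
    using cod[of 1 2 2] by (simp only: norm; linarith)
  \<comment> \<open>Here the swap leaves a derivative of \<open>H 1 1\<close> along another frame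
    vector. A second Codazzi equation evaluates it, by swapping in a diagonal \<open>H\<close> so
    that a vanishing off-diagonal one results; the other cases with two equations are alike.\<close>
  moreover have "?P 1 N13"
    using cod[of 1 3 1] cod[of 3 4 4] by (simp only: norm; linarith)
  moreover have "?P 1 N14"
    using cod[of 1 4 1] cod[of 4 3 3] by (simp only: norm; linarith)
  moreover have "?P 1 N23"
    using cod[of 1 3 2] by (simp only: norm; linarith)
  moreover have "?P 1 N24"
    using cod[of 1 4 2] by (simp only: norm; linarith)
  moreover have "?P 2 N0"
    using cod[of 2 1 1] by (simp only: norm; linarith)
  moreover have "?P 2 N13"
    using cod[of 2 3 1] by (simp only: norm; linarith)
  moreover have "?P 2 N14"
    using cod[of 2 4 1] by (simp only: norm; linarith)
  moreover have "?P 2 N23"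
    using cod[of 2 3 2] cod[of 3 4 4] by (simp only: norm; linarith)
  moreover have "?P 2 N24"
    using cod[of 2 4 2] cod[of 4 3 3] by (simp only: norm; linarith)
  moreover have "?P 3 N0"
    using cod[of 3 4 4] by (simp only: norm; linarith)
  moreover have "?P 3 N13"
    using cod[of 3 1 3] cod[of 1 2 2] by (simp only: norm; linarith)
  moreover have "?P 3 N14"
    using cod[of 3 1 4] by (simp only: norm; linarith)
  moreover have "?P 3 N23"
    using cod[of 3 2 3] cod[of 2 1 1] by (simp only: norm; linarith)
  moreover have "?P 3 N24"
    using cod[of 3 2 4] by (simp only: norm; linarith)
  moreover have "?P 4 N0"
    using cod[of 4 3 3] by (simp only: norm; linarith)
  moreover have "?P 4 N13"
    using cod[of 4 1 3] by (simp only: norm; linarith)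
  moreover have "?P 4 N14"
    using cod[of 4 1 4] cod[of 1 2 2] by (simp only: norm; linarith)
  moreover have "?P 4 N23"
    using cod[of 4 2 3] by (simp only: norm; linarith)
  moreover have "?P 4 N24"
    using cod[of 4 2 4] cod[of 2 1 1] by (simp only: norm; linarith)
  ultimately show ?thesis
    using exhaust_4[of k] by (cases a) (elim disjE; hypsubst; assumption)+
qed

text \<open>\<open>conn\<close> is linear in its argument with constant coefficients, so
  differentiation passes to the individual \<open>\<omega>\<close>.\<close>

lemma smooth_conn: "smooth_map_on V (\<lambda>v. conn (\<lambda>p i j. \<omega> p i j v) a b $ k)"
  and D_conn: "u \<in> V \<Longrightarrow>
    D l (\<lambda>v. conn (\<lambda>p i j. \<omega> p i j v) a b $ k) u = conn (\<lambda>p i j. D l (\<omega> p i j) u) a b $ k"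
proof -
  have sc: "smooth_map_on V (\<lambda>v. c * f v)" "u \<in> V \<Longrightarrow> D l (\<lambda>v. c * f v) u = c * D l f u"
    if "smooth_map_on V f" for c and f :: "real^4 \<Rightarrow> real"
    using smooth_map_on_scaleR[OF smooth_map_on_const[OF open_V, of c] that]
      D_scaleR[OF smooth_map_on_const[OF open_V, of c] that, of u l] by (simp_all add: D_const)
  have sm: "smooth_map_on V (\<lambda>v. - f v)" "u \<in> V \<Longrightarrow> D l (\<lambda>v. - f v) u = - D l f u"
    if "smooth_map_on V f" for f :: "real^4 \<Rightarrow> real"
    using sc[OF that, of "- 1"] by simp_all
  have sd: "smooth_map_on V (\<lambda>v. f v - h v)" if "smooth_map_on V f" "smooth_map_on V h" for f h :: "real^4 \<Rightarrow> real"
    using smooth_map_on_add[OF that(1) sm(1)[OF that(2)]] by simp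
  have k: "k = 1 \<or> k = 2 \<or> k = 3 \<or> k = 4" by (rule exhaust_4)
  show "smooth_map_on V (\<lambda>v. conn (\<lambda>p i j. \<omega> p i j v) a b $ k)"
    using k by (elim disjE; cases a; cases b) (simp_all add: sc sm sd smooth_map_on_add smooth_map_on_const open_V smooth_\<omega>)
  show "D l (\<lambda>v. conn (\<lambda>p i j. \<omega> p i j v) a b $ k) u = conn (\<lambda>p i j. D l (\<omega> p i j) u) a b $ k" if "u \<in> V"
    using k that by (elim disjE; cases a; cases b)
      (simp_all add: sc sm sd D_add D_diff D_const smooth_map_on_const open_V smooth_\<omega>)
qed

lemma weingarten_N:
  assumes u: "u \<in> V"
  shows "D k (N a) u = (\<Sum>b\<in>UNIV. (conn (\<lambda>p i j. \<omega> p i j u) a b $ k) *\<^sub>R N b u)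
    - (\<Sum>m\<in>UNIV. (N a u \<bullet> H k m u) *\<^sub>R E m u)"
  by (rule weingarten[OF u smooth_N N_normal normal_connection[OF u]])

lemma H_expansion:
  assumes u: "u \<in> V"
  shows "H i j u = (\<Sum>a\<in>UNIV. shape a $ i $ j *\<^sub>R N a u)"
  using exhaust_4[of i] exhaust_4[of j]
  by (elim disjE) (simp_all add: sum_normal_index H_type_B[OF u] H_transpose[OF u])

section \<open>Independence of the five normal fields and the Ricci equation in components\<close>

lemma first_normal_space_subset:
  assumes u: "u \<in> V"
  shows "first_normal_space g u \<subseteq> span (range (\<lambda>a. N a u))"
  unfolding first_normal_space_def second_fundamental_form_expansion[OF u] H_expansion[OF u]
  by (rule span_minimal) (auto intro!: span_sum span_scale intro: span_base)

text \<open>In dimension five the spanning fields are independent, since a dependence would leave a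
  spanning set of four. The part of \<open>N b\<close> orthogonal to the other four, rescaled, is
  the dual vector.\<close>

lemma dual_normal:
  assumes u: "u \<in> V" and dim: "dim (first_normal_space g u) = 5"
  obtains \<nu> where "\<And>m. \<nu> \<bullet> E m u = 0" "\<And>a. \<nu> \<bullet> N a u = (if a = b then 1 else 0)"
proof -
  let ?S = "(\<lambda>a. N a u) ` (UNIV - {b})"
  have "N b u \<notin> span ?S"
  proof
    assume "N b u \<in> span ?S"
    moreover have "range (\<lambda>a. N a u) = insert (N b u) ?S" by auto
    ultimately have "span (range (\<lambda>a. N a u)) = span ?S" by (simp add: span_redundant)
    then have "first_normal_space g u \<subseteq> span ?S" using first_normal_space_subset[OF u] by simp
    then have "dim (first_normal_space g u) \<le> card ?S" by (rule dim_le_card) simp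
    also have "\<dots> \<le> card (UNIV - {b})" by (rule card_image_le) simp
    also have "\<dots> \<le> 4" by (cases b) (simp_all add: UNIV_normal_index)
    finally show False using dim by simp
  qed
  obtain y z where yz: "y \<in> span ?S" "\<And>w. w \<in> span ?S \<Longrightarrow> orthogonal z w" "N b u = y + z"
    using orthogonal_subspace_decomp_exists by blast
  have "z \<noteq> 0" using yz(1,3) \<open>N b u \<notin> span ?S\<close> by auto
  \<comment> \<open>\<open>z\<close> is \<open>N b u\<close> minus a combination of the other
    fields, all of which are normal.\<close>
  have zE: "z \<bullet> E m u = 0" for m
  proof -
    have "?S \<subseteq> {x. x \<bullet> E m u = 0}" using N_normal[OF u] by auto
    moreover have "subspace {x. x \<bullet> E m u = 0}"
      by (auto simp: subspace_def inner_add_left)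
    ultimately have "y \<bullet> E m u = 0" using span_minimal yz(1) by blast
    then show ?thesis using N_normal[OF u, of b m] by (simp add: yz(3) inner_add_left)
  qed
  have zN: "z \<bullet> N a u = (if a = b then z \<bullet> z else 0)" for a
    using yz(2)[of "N a u"] yz(2)[OF yz(1)] by (auto simp: orthogonal_def span_base yz(3) inner_add_right)
  \<comment> \<open>As \<open>z\<close> is orthogonal to \<open>y\<close>, its product with
    \<open>N b u\<close> is \<open>z \<bullet> z\<close>, which fixes the scale.\<close>
  show ?thesis
  proof (rule that[of "z /\<^sub>R (z \<bullet> z)"])
    show "(z /\<^sub>R (z \<bullet> z)) \<bullet> E m u = 0" for m by (simp add: zE)
    show "(z /\<^sub>R (z \<bullet> z)) \<bullet> N a u = (if a = b then 1 else 0)" for a using \<open>z \<noteq> 0\<close> by (simp add: zN)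
  qed
qed

text \<open>Pairing the Ricci equation with the vector dual to \<open>N b\<close> isolates one
  coefficient and turns the pairings with \<open>H\<close> into entries of
  \<open>shape b\<close>.\<close>

lemma ricci_component:
  assumes u: "u \<in> V" and dim: "dim (first_normal_space g u) = 5"
  shows "conn (\<lambda>p i j. D k (\<omega> p i j) u) a b $ l - conn (\<lambda>p i j. D l (\<omega> p i j) u) a b $ k =
    (\<Sum>s\<in>UNIV. conn (\<lambda>p i j. \<omega> p i j u) a s $ k * conn (\<lambda>p i j. \<omega> p i j u) s b $ l
       - conn (\<lambda>p i j. \<omega> p i j u) a s $ l * conn (\<lambda>p i j. \<omega> p i j u) s b $ k) +
    (\<Sum>m\<in>UNIV. (\<omega> k l m u - \<omega> l k m u) * conn (\<lambda>p i j. \<omega> p i j u) a b $ m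
       + (N a u \<bullet> H l m u) * shape b $ k $ m - (N a u \<bullet> H k m u) * shape b $ l $ m)"
proof -
  obtain \<nu> where \<nu>: "\<And>m. \<nu> \<bullet> E m u = 0" "\<And>a. \<nu> \<bullet> N a u = (if a = b then 1 else 0)"
    using dual_normal[OF u dim, of b] by blast
  have "\<nu> \<bullet> H i j u = shape b $ i $ j" for i j
    by (simp add: H_expansion[OF u] inner_sum_right \<nu>(2) if_distrib cong: if_cong)
  then show ?thesis
    using ricci_equation[OF u \<nu>(1) smooth_N smooth_conn weingarten_N, of k a l]
    by (simp add: \<nu>(2) D_conn[OF u] sum.distrib sum_subtractf if_distrib cong: if_cong)
qed

lemma D_\<omega>_normalize:
  assumes u: "u \<in> V"
  shows "D l (\<omega> k i i) u = 0" "D l (\<omega> k 2 1) u = - D l (\<omega> k 1 2) u"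
    "D l (\<omega> k 3 1) u = - D l (\<omega> k 1 3) u" "D l (\<omega> k 4 1) u = - D l (\<omega> k 1 4) u"
    "D l (\<omega> k 3 2) u = - D l (\<omega> k 2 3) u" "D l (\<omega> k 4 2) u = - D l (\<omega> k 2 4) u"
    "D l (\<omega> k 4 3) u = - D l (\<omega> k 3 4) u"
proof -
  have *: "D l (\<omega> k i j) u = - D l (\<omega> k j i) u" for i j
  proof -
    have "D l (\<lambda>v. \<omega> k i j v + \<omega> k j i v) u = D l (\<lambda>_. 0) u"
      by (rule D_cong) (simp_all add: \<omega>_skew[of _ k i j] u smooth_map_on_add smooth_\<omega>)
    then show ?thesis by (simp add: D_add smooth_\<omega> u D_const)
  qed
  show "D l (\<omega> k i i) u = 0" using *[of i i] by simp
  show "D l (\<omega> k 2 1) u = - D l (\<omega> k 1 2) u"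
    "D l (\<omega> k 3 1) u = - D l (\<omega> k 1 3) u" "D l (\<omega> k 4 1) u = - D l (\<omega> k 1 4) u"
    "D l (\<omega> k 3 2) u = - D l (\<omega> k 2 3) u" "D l (\<omega> k 4 2) u = - D l (\<omega> k 2 4) u"
    "D l (\<omega> k 4 3) u = - D l (\<omega> k 3 4) u"
    by (rule *)+
qed

text \<open>The dimension enters at the point \<open>u\<close> alone, through
  \<open>dual_normal\<close>; \<open>weingarten_N\<close> holds throughout \<open>V\<close> whatever
  the rank of the five fields, which is why it can be differentiated.\<close>

lemma dim_first_normal_space_neq_5:
  assumes u: "u \<in> V"
  shows "dim (first_normal_space g u) \<noteq> 5"
proof
  assume dim: "dim (first_normal_space g u) = 5"
  note norm = sum_4 sum_normal_index conn.simps shape.simps vector_4 N.simps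
    \<omega>_normalize[OF u] D_\<omega>_normalize[OF u] H_type_B[OF u] H_transpose[OF u]
  note ricci = ricci_component[OF u dim]
  \<comment> \<open>Only four derivatives occur in these six equations:
    \<open>D 1 (\<omega> 4 1 4)\<close>, \<open>D 4 (\<omega> 1 1 4)\<close>,
    \<open>D 2 (\<omega> 3 2 3)\<close> and \<open>D 3 (\<omega> 2 2 3)\<close>. Those in
    \<open>r2\<close> and \<open>g1\<close> belong to the plane of frame vectors 1 and 4, those in
    \<open>r3\<close> and \<open>g2\<close> to the plane of 2 and 3, while \<open>r1\<close> and
    \<open>r4\<close> mix the two. The squared length of \<open>H 1 1\<close> enters through
    \<open>r1\<close>, \<open>r4\<close>, \<open>g1\<close>, \<open>g2\<close> and must cancel as
    well.\<close>
  note r1 = ricci[where k=1 and l=3 and a=N0 and b=N13, simplified norm]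
    and r2 = ricci[where k=1 and l=4 and a=N14 and b=N0, simplified norm]
    and r3 = ricci[where k=2 and l=3 and a=N23 and b=N0, simplified norm]
    and r4 = ricci[where k=2 and l=4 and a=N0 and b=N24, simplified norm]
    and g1 = gauss_equation[OF u, of 1 4 1 4, simplified norm]
    and g2 = gauss_equation[OF u, of 2 3 2 3, simplified norm]
  \<comment> \<open>weights \<open>1/3\<close> for \<open>r1\<close>, \<open>r4\<close>, \<open>1/6\<close> for \<open>r2\<close>, \<open>r3\<close> and \<open>2/3\<close> for \<open>g1\<close>, \<open>g2\<close>, up to sign\<close>
  have "H 1 4 u \<bullet> H 1 4 u + H 2 3 u \<bullet> H 2 3 u = 0"
    using r1 r2 r3 r4 g1 g2 by (simp add: inner_commute algebra_simps)
  then have "N N14 u = 0"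
    by (simp add: add_nonneg_eq_0_iff)
  moreover obtain \<nu> where "\<nu> \<bullet> N N14 u = 1"
    using dual_normal[OF u dim, of N14] by metis
  ultimately show False by simp
qed

end

theorem proposition11:
  fixes X :: "'m topology"
    and A :: "('m, 4) atlas"
    and F :: "'m \<Rightarrow> real^'n"
    and r \<delta> :: nat
  assumes "CARD('n) = 4 + r"
    and "immersed_submanifold X A F"
    and "austere A F"
    and "type_B A F"
    and "first_normal_dimension A F \<delta>"
  shows "\<delta> \<noteq> 5"
proof -
  \<comment> \<open>The argument is local: nonemptiness supplies a point, the atlas a
    parametrization around it, and type B an adapted frame on a neighbourhood.\<close>
  have "topspace X \<noteq> {}" and cover: "(\<Union>(U, \<phi>)\<in>A. \<phi> ` U) = topspace X"
    using assms(2) by (auto simp: immersed_submanifold_def smooth_manifold_def smooth_atlas_def)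
  then obtain U \<phi> u where chart: "(U, \<phi>) \<in> A" and u: "u \<in> U"
    by fast
  obtain V e where V: "open V" "u \<in> V" "V \<subseteq> U"
    and frame: "smooth_orthonormal_frame (F \<circ> \<phi>) V e"
    and Q: "\<forall>v\<in>V. form_matrix (e v) ` second_fundamental_forms (F \<circ> \<phi>) v \<subseteq> Q_B"
    using assms(4) chart u unfolding type_B_def by fast
  have "immersion_on U (F \<circ> \<phi>)"
    using assms(2) chart by (auto simp: immersed_submanifold_def)
  then have "immersion_on V (F \<circ> \<phi>)"
    using V(1,3) smooth_map_on_subset unfolding immersion_on_def by blast
  then interpret type_B_frame "F \<circ> \<phi>" V e
    using frame Q by unfold_locales auto
  have "dim (first_normal_space (F \<circ> \<phi>) u) = \<delta>"
    using assms(5) chart u by (auto simp: first_normal_dimension_def)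
  then show ?thesis using dim_first_normal_space_neq_5[OF V(2)] by simp
qed

end
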